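(* Let $p_H^r\in\mathbb{R}^3$ be a constant human position reference with $z_W^\top p_H^r=0$, and let $f_z\in\mathbb{R}$. Consider the human–cable–robot system with state $x=[p_H^\top\ v_H^\top\ p_R^\top\ v_R^\top]^\top\in\mathcal{X}$ and dynamics $$\dot p_H=v_H,\quad \dot v_H=\tfrac1{m_H}\left(-m_Hg\,z_W-B_Hv_H+f_c+f_g\right),\quad \dot p_R=v_R,\quad \dot v_R=M_A^{-1}\left(-B_Av_R-f_c+u_A\right),$$ under the control law $$u_A=K_H\,(p_R^r-p_R)+f_c^r,$$ where $$f_c^r=f_z z_W,\qquad p_R^r=p_H^r+f_c^r\left(\frac1{k_c}+\frac{\bar l_c}{\|f_c^r\|}\right).$$ If $0<f_z<m_Hg$, then the zero-velocity equilibrium $\bar x=[(p_H^r)^\top\ 0^\top\ (p_R^r)^\top\ 0^\top]^\top$, which satisfies $\|p_R^r-p_H^r\|>\bar l_c$ (the cable is taut), is an asymptotically stable equilibrium of the closed-loop system.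
   Context: Constants: $m_H,g,k_c,\bar l_c,k_H>0$; $B_H\in\mathbb{R}^{3\times3}$ positive definite; $M_A,B_A\in\mathbb{R}^{3\times 3}$ positive definite diagonal; $K_H=\mathrm{diag}(k_H,k_H,0)$. $\{x_W,y_W,z_W\}$ is the canonical orthonormal basis of $\mathbb{R}^3$, with $z_W$ pointing vertically upward. $p_H,v_H\in\mathbb{R}^3$ are the position and velocity of the human (hand), and $p_R,v_R\in\mathbb{R}^3$ those of the aerial robot. Cable force: let $l_c=p_R-p_H$ and define the tension $t_c(\ell)=k_c(\ell-\bar l_c)$ if $\ell>\bar l_c$ and $t_c(\ell)=0$ otherwise. The cable force on the human is $f_c=t_c(\|l_c\|)\,l_c/\|l_c\|$ (equal to $0$ when $\|l_c\|\le\bar l_c$, including $l_c=0$). The force on the robot is $-f_c$. Ground constraint: the ground is flat and horizontal and the human is constrained to it, i.e. the state space is $\mathcal{X}=\{x\in\mathbb{R}^{12}: z_W^\top p_H=0,\ z_W^\top v_H=0\}$. The ground reaction $f_g$ is vertical, $f_g=\lambda z_W$, where the scalar $\lambda$ is the value for which $z_W^\top\dot v_H=0$. It is a standing assumption that the human stays on the ground (the reaction intensity satisfies $\lambda\ge 0$; the cable never lifts the human). Stability is understood for the closed-loop dynamics on $\mathcal{X}$. *)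

theory Defs
  imports "HOL-Analysis.Analysis"
begin

text \<open>Symmetry is not part of the definition.\<close>

definition pos_def :: "real^'n^'n \<Rightarrow> bool" where
  "pos_def A \<longleftrightarrow> (\<forall>v. v \<noteq> 0 \<longrightarrow> v \<bullet> (A *v v) > 0)"

definition is_diagonal :: "'a::zero^'n^'n \<Rightarrow> bool" where
  "is_diagonal A \<longleftrightarrow> (\<forall>i j. i \<noteq> j \<longrightarrow> A $ i $ j = 0)"

definition diag :: "'a::zero^'n \<Rightarrow> 'a^'n^'n" where
  "diag d = (\<chi> i j. if i = j then d $ i else 0)"

definition z_W :: "real^3" where
  "z_W = axis 3 1"

text \<open>A state is a tuple \<open>(p_H, v_H, p_R, v_R)\<close>; the norm of the product type is the
  Euclidean norm in dimension 12.\<close>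

type_synonym state = "(real^3) \<times> (real^3) \<times> (real^3) \<times> (real^3)"

definition state_space :: "state set" where
  "state_space = {(p_H, v_H, p_R, v_R). z_W \<bullet> p_H = 0 \<and> z_W \<bullet> v_H = 0}"

definition tension :: "real \<Rightarrow> real \<Rightarrow> real \<Rightarrow> real" where
  "tension k_c lbar_c l = (if l > lbar_c then k_c * (l - lbar_c) else 0)"

text \<open>The value at \<open>l_c = 0\<close> is \<open>0\<close>.\<close>

definition cable_force :: "real \<Rightarrow> real \<Rightarrow> real^3 \<Rightarrow> real^3" where
  "cable_force k_c lbar_c l_c = (tension k_c lbar_c (norm l_c) / norm l_c) *\<^sub>R l_c"

definition human_acc ::
  "real \<Rightarrow> real \<Rightarrow> real \<Rightarrow> real \<Rightarrow> real^3^3 \<Rightarrow> real \<Rightarrow> state \<Rightarrow> real^3" where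
  "human_acc m_H g k_c lbar_c B_H lam = (\<lambda>(p_H, v_H, p_R, v_R).
     (1 / m_H) *\<^sub>R (- (m_H * g) *\<^sub>R z_W - B_H *v v_H
        + cable_force k_c lbar_c (p_R - p_H) + lam *\<^sub>R z_W))"

text \<open>The intensity of the ground reaction is fixed by the constraint; it is unique for
  \<open>m_H \<noteq> 0\<close>, since the vertical acceleration is affine in it with slope \<open>1 / m_H\<close>.\<close>

definition ground_intensity ::
  "real \<Rightarrow> real \<Rightarrow> real \<Rightarrow> real \<Rightarrow> real^3^3 \<Rightarrow> state \<Rightarrow> real" where
  "ground_intensity m_H g k_c lbar_c B_H x =
     (THE lam. z_W \<bullet> human_acc m_H g k_c lbar_c B_H lam x = 0)"

definition robot_acc ::
  "real \<Rightarrow> real \<Rightarrow> real^3^3 \<Rightarrow> real^3^3 \<Rightarrow> real^3 \<Rightarrow> state \<Rightarrow> real^3" where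
  "robot_acc k_c lbar_c M_A B_A u = (\<lambda>(p_H, v_H, p_R, v_R).
     matrix_inv M_A *v (- (B_A *v v_R) - cable_force k_c lbar_c (p_R - p_H) + u))"

definition system_field ::
  "real \<Rightarrow> real \<Rightarrow> real \<Rightarrow> real \<Rightarrow> real^3^3 \<Rightarrow> real^3^3 \<Rightarrow> real^3^3 \<Rightarrow> real^3 \<Rightarrow> state \<Rightarrow> state" where
  "system_field m_H g k_c lbar_c B_H M_A B_A u x = (case x of (p_H, v_H, p_R, v_R) \<Rightarrow>
     (v_H,
      human_acc m_H g k_c lbar_c B_H (ground_intensity m_H g k_c lbar_c B_H x) x,
      v_R,
      robot_acc k_c lbar_c M_A B_A u x))"

definition force_ref :: "real \<Rightarrow> real^3" where
  "force_ref f_z = f_z *\<^sub>R z_W"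

definition robot_ref :: "real \<Rightarrow> real \<Rightarrow> real^3 \<Rightarrow> real^3 \<Rightarrow> real^3" where
  "robot_ref k_c lbar_c p_Hr f_cr = p_Hr + (1 / k_c + lbar_c / norm f_cr) *\<^sub>R f_cr"

definition control :: "real^3^3 \<Rightarrow> real^3 \<Rightarrow> real^3 \<Rightarrow> state \<Rightarrow> real^3" where
  "control K_H p_Rr f_cr = (\<lambda>(p_H, v_H, p_R, v_R). K_H *v (p_Rr - p_R) + f_cr)"

text \<open>Solutions of the autonomous equation \<open>x' = F x\<close> on \<open>[0, \<infinity>)\<close> that remain in the state
  space and along which the human stays on the ground, i.e. the intensity \<open>lam\<close> of the ground
  reaction is nonnegative.\<close>

definition motion :: "('a::real_normed_vector \<Rightarrow> 'a) \<Rightarrow> 'a set \<Rightarrow> ('a \<Rightarrow> real) \<Rightarrow> (real \<Rightarrow> 'a) \<Rightarrow> bool" where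
  "motion F X lam x \<longleftrightarrow>
     (\<forall>t\<ge>0. x t \<in> X \<and> (x has_vector_derivative F (x t)) (at t within {0..}) \<and> lam (x t) \<ge> 0)"

definition equilibrium :: "('a::real_normed_vector \<Rightarrow> 'a) \<Rightarrow> 'a set \<Rightarrow> 'a \<Rightarrow> bool" where
  "equilibrium F X xb \<longleftrightarrow> xb \<in> X \<and> F xb = 0"

text \<open>The notions below are relative to a state space \<open>X\<close> and a set of motions, given as a
  predicate \<open>mot\<close> on functions of time.\<close>

definition well_posed_near ::
  "((real \<Rightarrow> 'a::metric_space) \<Rightarrow> bool) \<Rightarrow> 'a set \<Rightarrow> 'a \<Rightarrow> bool" where
  "well_posed_near mot X xb \<longleftrightarrow>
     (\<exists>d>0. \<forall>x0\<in>X. dist x0 xb < d \<longrightarrow> (\<exists>x. mot x \<and> x 0 = x0))"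

definition lyapunov_stable :: "((real \<Rightarrow> 'a::metric_space) \<Rightarrow> bool) \<Rightarrow> 'a \<Rightarrow> bool" where
  "lyapunov_stable mot xb \<longleftrightarrow>
     (\<forall>e>0. \<exists>d>0. \<forall>x. mot x \<and> dist (x 0) xb < d \<longrightarrow> (\<forall>t\<ge>0. dist (x t) xb < e))"

definition locally_attractive :: "((real \<Rightarrow> 'a::metric_space) \<Rightarrow> bool) \<Rightarrow> 'a \<Rightarrow> bool" where
  "locally_attractive mot xb \<longleftrightarrow>
     (\<exists>d>0. \<forall>x. mot x \<and> dist (x 0) xb < d \<longrightarrow> (x \<longlongrightarrow> xb) at_top)"

text \<open>The first conjunct states explicitly that motions starting near \<open>xb\<close> exist for all time,
  so that the quantifications over motions in the other two are not vacuous.\<close>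

definition asymptotically_stable ::
  "((real \<Rightarrow> 'a::metric_space) \<Rightarrow> bool) \<Rightarrow> 'a set \<Rightarrow> 'a \<Rightarrow> bool" where
  "asymptotically_stable mot X xb \<longleftrightarrow>
     well_posed_near mot X xb \<and> lyapunov_stable mot xb \<and> locally_attractive mot xb"

end

theory Submission
  imports Defs
begin

text \<open>On the state space the total energy, consisting of the kinetic energies, the elastic energy of
  the cable minus the work of the reference force, and the energy of the horizontal feedback,
  dissipates as \<open>- v_H \<bullet> B_H v_H - v_R \<bullet> B_A v_R\<close>.  Its potential part is bounded below by a multiple of
  the squared displacement: as \<open>f_z > 0\<close>, the cable resists both elongation and tilting, and the
  ground constraint removes the common vertical translation.  Adding a small multiple of
  the inner product of momentum and displacement gives a strict Lyapunov function with quadratic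
  bounds, so motions decay exponentially and no invariance principle is needed.  Since
  \<open>f_z < m_H g\<close>, the ground reaction is positive near the equilibrium.  Existence of motions follows
  by solving a globally Lipschitz truncation of the field, whose solutions from nearby states never
  reach the region where it was changed.\<close>

subsection \<open>Global solutions of Lipschitz equations\<close>

text \<open>The fundamental theorem of calculus on \<open>{0..t+1}\<close> suffices: this interval
  reaches past \<open>t\<close>, so it coincides with the half-line near \<open>t\<close>.\<close>

lemma integral_has_vector_derivative_halfline:
  fixes h :: "real \<Rightarrow> 'a::banach"
  assumes h: "continuous_on UNIV h" and "t \<ge> 0"
  shows "((\<lambda>u. integral {0..u} h) has_vector_derivative h t) (at t within {0..})"
proof -
  have "((\<lambda>u. integral {0..u} h) has_vector_derivative h t) (at t within {0..t+1})"
    using assms by (intro integral_has_vector_derivative continuous_on_subset[OF h]) auto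
  moreover have "at t within {0..t+1} = at t within {0..}"
    by (rule at_within_nhd[of t "{..<t+1}"]) auto
  ultimately show ?thesis
    by simp
qed

text \<open>Integrating \<open>exp (K * s)\<close> gains a factor \<open>1 / K\<close>, and the
  weight cancels the remaining exponential. This yields both the boundedness and the contraction
  factor of the Picard map.\<close>

lemma weighted_integral_bound:
  fixes h :: "real \<Rightarrow> 'a::banach"
  assumes h: "continuous_on UNIV h" and t: "t \<ge> 0" and K: "K > 0"
    and bound: "\<And>s. s \<ge> 0 \<Longrightarrow> norm (h s) \<le> C * exp (K * s)"
  shows "norm (exp (- (K * t)) *\<^sub>R integral {0..t} h) \<le> C / K"
proof -
  have I: "((\<lambda>s. C * exp (K * s)) has_integral (C / K * exp (K * t) - C / K * exp (K * 0))) {0..t}"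
    using K t by (intro fundamental_theorem_of_calculus)
      (auto intro!: derivative_eq_intros simp flip: has_real_derivative_iff_has_vector_derivative)
  have C: "C \<ge> 0"
    using order_trans[OF norm_ge_zero bound[of 0]] by simp
  have "norm (integral {0..t} h) \<le> integral {0..t} (\<lambda>s. C * exp (K * s))"
    using bound
    by (intro integral_norm_bound_integral integrable_continuous_real continuous_on_subset[OF h]
        continuous_intros) auto
  also have "\<dots> \<le> C / K * exp (K * t)"
    using integral_unique[OF I] C K by simp
  finally have "exp (- (K * t)) * norm (integral {0..t} h) \<le> exp (- (K * t)) * (C / K * exp (K * t))"
    by (intro mult_left_mono) auto
  also have "\<dots> = C / K"
    by (simp add: exp_minus field_simps)
  finally show ?thesis
    by simp
qed

text \<open>Picard iteration is a contraction on the whole half-line when the difference from the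
  initial value is measured with the weight \<open>exp (- K t)\<close> for large \<open>K\<close>.\<close>

theorem lipschitz_global_solution:
  fixes G :: "'a::banach \<Rightarrow> 'a"
  assumes G: "L-lipschitz_on UNIV G"
  obtains x where "x 0 = x0"
    "\<And>t. t \<ge> 0 \<Longrightarrow> (x has_vector_derivative G (x t)) (at t within {0..})"
proof -
  \<comment> \<open>Makes \<open>L / K\<close> less than 1, also when \<open>L = 0\<close>.\<close>
  define K where "K = 2 * L + 1"
  have L: "L \<ge> 0"
    using G by (rule lipschitz_on_nonneg)
  then have K: "K > 0"
    by (simp add: K_def)
  \<comment> \<open>The unknown is the rescaled increment \<open>y\<close>, with solution
    \<open>x0 + exp (K * s) *\<^sub>R y s\<close>; \<open>H y\<close> is the field along it.\<close>
  define H :: "(real \<Rightarrow>\<^sub>C 'a) \<Rightarrow> real \<Rightarrow> 'a" where "H y s = G (x0 + exp (K * s) *\<^sub>R y s)" for y s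
  have G_cont: "continuous_on UNIV G"
    using G by (rule lipschitz_on_continuous_on)
  have H_cont: "continuous_on UNIV (H y)" for y
    unfolding H_def by (intro continuous_on_compose2[OF G_cont] continuous_intros) auto
  \<comment> \<open>Bounded continuous functions live on the whole line, hence the constant
    extension to negative times by \<open>max 0 t\<close>.\<close>
  define P where "P y t = exp (- (K * max 0 t)) *\<^sub>R integral {0..max 0 t} (H y)" for y t
  have H_diff: "norm (H y s - H z s) \<le> L * dist y z * exp (K * s)" for y z s
  proof -
    have "norm (H y s - H z s)
        \<le> L * norm ((x0 + exp (K * s) *\<^sub>R y s) - (x0 + exp (K * s) *\<^sub>R z s))"
      unfolding H_def by (rule lipschitz_on_normD[OF G]) auto
    also have "\<dots> = L * (exp (K * s) * dist (y s) (z s))"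
      by (simp add: dist_norm flip: scaleR_diff_right)
    also have "\<dots> \<le> L * (exp (K * s) * dist y z)"
      using L dist_bounded[of y s z] by (intro mult_left_mono) auto
    finally show ?thesis
      by (simp add: mult_ac)
  qed
  have P_cont: "continuous_on UNIV (P y)" for y
  proof -
    have "continuous_on {0..} (\<lambda>u. integral {0..u} (H y))"
      unfolding continuous_on_eq_continuous_within
      using integral_has_vector_derivative_halfline[OF H_cont[of y]] has_vector_derivative_continuous
      by fastforce
    then have "continuous_on UNIV (\<lambda>t. integral {0..max 0 t} (H y))"
      by (rule continuous_on_compose2) (auto intro!: continuous_intros)
    then show ?thesis
      unfolding P_def by (intro continuous_intros)
  qed
  have P_bound: "norm (P y t) \<le> (norm (G x0) + L * norm y) / K" for y t
    unfolding P_def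
  proof (rule weighted_integral_bound[OF H_cont _ K])
    fix s :: real assume s: "s \<ge> 0"
    \<comment> \<open>\<open>H 0 s\<close> is the constant \<open>G x0\<close>, so the Lipschitz
      estimate against \<open>0\<close> gives boundedness.\<close>
    have "norm (H y s) \<le> norm (H 0 s) + norm (H y s - H 0 s)"
      by (metis add.commute diff_add_cancel norm_triangle_ineq)
    also have "\<dots> \<le> norm (G x0) * exp (K * s) + L * norm y * exp (K * s)"
      using H_diff[of y s 0] s K mult_left_mono[of 1 "exp (K * s)" "norm (G x0)"]
      by (intro add_mono) (auto simp: H_def)
    finally show "norm (H y s) \<le> (norm (G x0) + L * norm y) * exp (K * s)"
      by (simp add: algebra_simps)
  qed simp
  have P_bcontfun: "P y \<in> bcontfun" for y
    by (rule bcontfun_normI[OF P_cont P_bound])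
  define T where "T y = Bcontfun (P y)" for y
  have T: "apply_bcontfun (T y) = P y" for y
    unfolding T_def by (rule Bcontfun_inverse[OF P_bcontfun])
  have "dist (T y) (T z) \<le> L / K * dist y z" for y z
  proof (rule dist_bound)
    fix t
    have "P y t - P z t
        = exp (- (K * max 0 t)) *\<^sub>R integral {0..max 0 t} (\<lambda>s. H y s - H z s)"
      unfolding P_def
      by (subst Henstock_Kurzweil_Integration.integral_diff)
        (auto intro!: integrable_continuous_real continuous_on_subset[OF H_cont]
          simp: scaleR_diff_right)
    also have "norm \<dots> \<le> L * dist y z / K"
      by (intro weighted_integral_bound continuous_intros H_cont K H_diff) auto
    finally show "dist (T y t) (T z t) \<le> L / K * dist y z"
      by (simp add: T dist_norm)
  qed
  moreover have "0 \<le> L / K" "L / K < 1"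
    using L K by (auto simp: K_def field_simps)
  ultimately obtain y where y: "T y = y"
    using banach_fix_type[of "L / K" T] by blast
  define x where "x t = x0 + integral {0..t} (H y)" for t
  have x: "x t = x0 + exp (K * t) *\<^sub>R y t" if "t \<ge> 0" for t
  proof -
    have "y t = exp (- (K * t)) *\<^sub>R integral {0..t} (H y)"
      using T[of y] that by (simp add: y P_def)
    then show ?thesis
      by (simp add: x_def flip: exp_add)
  qed
  show thesis
  proof
    show "x 0 = x0"
      by (simp add: x_def)
    fix t :: real assume t: "t \<ge> 0"
    have "(x has_vector_derivative 0 + H y t) (at t within {0..})"
      unfolding x_def
      by (intro has_vector_derivative_add has_vector_derivative_const
          integral_has_vector_derivative_halfline[OF H_cont t])
    then show "(x has_vector_derivative G (x t)) (at t within {0..})"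
      using x[OF t] by (simp add: H_def)
  qed
qed

subsection \<open>Strict Lyapunov functions\<close>

text \<open>All conditions are local, in a ball and on \<open>X\<close>: the energy used below fits
  the dynamics only while the cable is taut.\<close>

locale strict_lyapunov =
  fixes F :: "'a::euclidean_space \<Rightarrow> 'a" and X :: "'a set" and xb :: 'a
    and W :: "'a \<Rightarrow> real" and W' :: "'a \<Rightarrow> 'a \<Rightarrow> real" and r c1 c2 c3 :: real
  assumes pos: "r > 0" "c1 > 0" "c2 > 0" "c3 > 0"
    and lower: "\<And>z. z \<in> X \<Longrightarrow> dist z xb \<le> r \<Longrightarrow> c1 * (dist z xb)\<^sup>2 \<le> W z"
    and upper: "\<And>z. z \<in> X \<Longrightarrow> dist z xb \<le> r \<Longrightarrow> W z \<le> c2 * (dist z xb)\<^sup>2"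
    and deriv: "\<And>z. z \<in> X \<Longrightarrow> dist z xb \<le> r \<Longrightarrow> (W has_derivative W' z) (at z)"
    and decrease: "\<And>z. z \<in> X \<Longrightarrow> dist z xb \<le> r \<Longrightarrow> W' z (F z) \<le> - c3 * (dist z xb)\<^sup>2"
begin

text \<open>Covers the motions of \<open>F\<close> as well as the solutions of a field that agrees with \<open>F\<close> only
  near \<open>xb\<close>.\<close>

definition local_solution :: "(real \<Rightarrow> 'a) \<Rightarrow> bool" where
  "local_solution x \<longleftrightarrow> continuous_on {0..} x \<and> (\<forall>t\<ge>0. x t \<in> X \<and>
     (dist (x t) xb \<le> r \<longrightarrow> (x has_vector_derivative F (x t)) (at t within {0..})))"

lemma motion_local_solution: "motion F X lam x \<Longrightarrow> local_solution x"
  unfolding motion_def local_solution_def continuous_on_eq_continuous_within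
  by (auto intro: has_vector_derivative_continuous)

text \<open>The upper bound turns \<open>decrease\<close> into the differential inequality W' \<le>
  - (c3 / c2) W, so \<open>W (x t) * exp (c3 / c2 * t)\<close> is nonincreasing.\<close>

lemma exponential_decay:
  assumes x: "local_solution x" and "T \<ge> 0"
    and ball: "\<And>t. 0 \<le> t \<Longrightarrow> t \<le> T \<Longrightarrow> dist (x t) xb \<le> r"
  shows "W (x T) \<le> W (x 0) * exp (- (c3 / c2 * T))"
proof -
  define E where "E t = W (x t) * exp (c3 / c2 * t)" for t
  have x_deriv: "(x has_vector_derivative F (x t)) (at t within {0..})" and X: "x t \<in> X"
    if "0 \<le> t" "t \<le> T" for t
    using x ball that by (auto simp: local_solution_def)
  have W_deriv: "((\<lambda>t. W (x t)) has_real_derivative W' (x t) (F (x t))) (at t within {0..})"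
    if t: "0 \<le> t" "t \<le> T" for t
  proof -
    have D: "(W has_derivative W' (x t)) (at (x t))"
      using deriv[OF X ball] t by auto
    have "((\<lambda>t. W (x t)) has_vector_derivative W' (x t) (F (x t))) (at t within {0..})"
      using vector_derivative_diff_chain_within[OF x_deriv[OF t] has_derivative_at_withinI[OF D]]
      by (simp add: o_def)
    then show ?thesis
      by (simp add: has_real_derivative_iff_has_vector_derivative)
  qed
  have "E T \<le> E 0"
  proof (rule DERIV_nonpos_imp_decreasing_open[OF \<open>T \<ge> 0\<close>])
    fix t assume t: "0 < t" "t < T"
    \<comment> \<open>Two-sided derivatives are needed at interior times only; continuity covers the
      endpoints.\<close>
    have "at t within {0..} = at t"
      using t by (intro at_within_interior) auto
    then have D: "((\<lambda>t. W (x t)) has_real_derivative W' (x t) (F (x t))) (at t)"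
      using W_deriv[of t] t by simp
    have "(E has_real_derivative
        W (x t) * (c3 / c2 * exp (c3 / c2 * t)) + W' (x t) (F (x t)) * exp (c3 / c2 * t)) (at t)"
      unfolding E_def by (rule derivative_eq_intros D refl | simp)+
    moreover have "W (x t) * (c3 / c2) + W' (x t) (F (x t)) \<le> 0"
    proof -
      have "W (x t) * (c3 / c2) \<le> c2 * (dist (x t) xb)\<^sup>2 * (c3 / c2)"
        using upper[OF X ball, of t] t pos by (intro mult_right_mono) auto
      also have "\<dots> = c3 * (dist (x t) xb)\<^sup>2"
        using pos by simp
      finally show ?thesis
        using decrease[OF X ball, of t] t by simp
    qed
    then have "exp (c3 / c2 * t) * (W (x t) * (c3 / c2) + W' (x t) (F (x t))) \<le> 0"
      by (intro mult_nonneg_nonpos) auto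
    then have "W (x t) * (c3 / c2 * exp (c3 / c2 * t)) + W' (x t) (F (x t)) * exp (c3 / c2 * t) \<le> 0"
      by (simp add: algebra_simps)
    ultimately show "\<exists>y. (E has_real_derivative y) (at t) \<and> y \<le> 0"
      by blast
  next
    have "continuous_on {0..T} (\<lambda>t. W (x t))"
      unfolding continuous_on_eq_continuous_within
      using DERIV_continuous[OF DERIV_subset[OF W_deriv], of _ "{0..T}"] by auto
    then show "continuous_on {0..T} E"
      unfolding E_def by (intro continuous_intros)
  qed
  then have "E T * exp (- (c3 / c2 * T)) \<le> W (x 0) * exp (- (c3 / c2 * T))"
    by (simp add: E_def)
  then show ?thesis
    by (simp add: E_def mult.assoc flip: exp_add)
qed

text \<open>First-exit argument: at the first time at distance \<open>\<rho>\<close>,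
  \<open>W\<close> would be at least \<open>c1 * \<rho>\<^sup>2\<close>, while the decay up to that
  time keeps it below this value.\<close>

lemma local_solution_stays:
  assumes x: "local_solution x" and \<rho>: "0 < \<rho>" "\<rho> \<le> r"
    and start: "dist (x 0) xb < \<rho>" "c2 * (dist (x 0) xb)\<^sup>2 < c1 * \<rho>\<^sup>2" and "t \<ge> 0"
  shows "dist (x t) xb < \<rho>"
proof (rule ccontr)
  assume far: "\<not> dist (x t) xb < \<rho>"
  \<comment> \<open>The times up to \<open>t\<close> at which the ball has been left. This set is
    compact, so there is a first one, \<open>T\<close>.\<close>
  define S where "S = {0..t} \<inter> (\<lambda>s. dist (x s) xb) -` {\<rho>..}"
  have cont: "continuous_on {0..t} (\<lambda>s. dist (x s) xb)"
    using x unfolding local_solution_def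
    by (intro continuous_intros) (auto intro: continuous_on_subset)
  have "compact S"
    unfolding S_def using continuous_closed_preimage[OF cont, of "{\<rho>..}"]
    by (auto simp: compact_eq_bounded_closed intro: bounded_subset[of "{0..t}"])
  moreover have "t \<in> S"
    using far \<open>t \<ge> 0\<close> by (simp add: S_def)
  ultimately obtain T where T: "T \<in> S" "\<And>s. s \<in> S \<Longrightarrow> T \<le> s"
    using compact_attains_inf[of S] by blast
  have T0: "0 \<le> T" "T \<le> t" "\<rho> \<le> dist (x T) xb"
    using T(1) by (auto simp: S_def)
  have before: "dist (x s) xb < \<rho>" if "0 \<le> s" "s < T" for s
    using T(2)[of s] that T0 by (force simp: S_def)
  \<comment> \<open>Equality at \<open>T\<close>, by the intermediate value theorem, keeps the
    solution within radius \<open>r\<close> up to and including \<open>T\<close>, as the decay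
    estimate requires.\<close>
  have "dist (x T) xb \<le> \<rho>"
  proof -
    have "\<exists>s\<ge>0. s \<le> T \<and> dist (x s) xb = \<rho>"
      using start T0 \<open>t \<ge> 0\<close>
      by (intro IVT' continuous_on_subset[OF cont]) auto
    then obtain s where s: "0 \<le> s" "s \<le> T" "dist (x s) xb = \<rho>"
      by blast
    with before[of s] show ?thesis
      by (cases "s = T") auto
  qed
  with T0 have T\<rho>: "dist (x T) xb = \<rho>"
    by simp
  have ball: "dist (x s) xb \<le> r" if "0 \<le> s" "s \<le> T" for s
    using before[of s] that \<rho> T\<rho> by (cases "s = T") auto
  have X: "x s \<in> X" if "0 \<le> s" for s
    using x that by (simp add: local_solution_def)
  have W0: "0 \<le> W (x 0)" "W (x 0) \<le> c2 * (dist (x 0) xb)\<^sup>2"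
    using order_trans[OF _ lower[OF X[of 0] ball[of 0]], of 0] upper[OF X[of 0] ball[of 0]] T0 pos
    by auto
  have "c1 * \<rho>\<^sup>2 \<le> W (x T)"
    using lower[OF X ball, of T] T0 T\<rho> by simp
  also have "\<dots> \<le> W (x 0) * exp (- (c3 / c2 * T))"
    using x T0(1) ball by (rule exponential_decay)
  also have "\<dots> \<le> W (x 0)"
    using W0 pos T0 by (intro mult_left_le) auto
  finally show False
    using W0 start by simp
qed

text \<open>The minimum with 1 places the start inside the ball; the square root makes its upper
  bound on \<open>W\<close> at most half of the level \<open>c1 * \<rho>\<^sup>2\<close>, and the
  factor 2 provides strictness.\<close>

definition basin_radius :: "real \<Rightarrow> real" where
  "basin_radius \<rho> = \<rho> * min 1 (sqrt (c1 / (2 * c2)))"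

lemma basin_radius_pos: "\<rho> > 0 \<Longrightarrow> basin_radius \<rho> > 0"
  using pos by (simp add: basin_radius_def)

text \<open>Used with \<open>\<rho> = r\<close> for existence and attraction, and with
  \<open>\<rho> = min e r\<close> for stability.\<close>

lemma stays_in_ball:
  assumes "local_solution x" "0 < \<rho>" "\<rho> \<le> r" "dist (x 0) xb < basin_radius \<rho>" "t \<ge> 0"
  shows "dist (x t) xb < \<rho>"
proof -
  let ?d = "dist (x 0) xb"
  have "?d < \<rho>"
  proof -
    have "basin_radius \<rho> \<le> \<rho>"
      unfolding basin_radius_def using assms(2) by (intro mult_left_le) auto
    with assms(4) show ?thesis
      by simp
  qed
  moreover have "c2 * ?d\<^sup>2 < c1 * \<rho>\<^sup>2"
  proof -
    have "basin_radius \<rho> \<le> \<rho> * sqrt (c1 / (2 * c2))"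
      unfolding basin_radius_def using assms(2) by (intro mult_left_mono) auto
    then have "?d \<le> \<rho> * sqrt (c1 / (2 * c2))"
      using assms(4) by linarith
    then have "?d\<^sup>2 \<le> (\<rho> * sqrt (c1 / (2 * c2)))\<^sup>2"
      by (intro power_mono) auto
    also have "\<dots> = \<rho>\<^sup>2 * (c1 / (2 * c2))"
      using pos by (simp add: power_mult_distrib)
    finally have "c2 * ?d\<^sup>2 \<le> c2 * (\<rho>\<^sup>2 * (c1 / (2 * c2)))"
      using pos by (intro mult_left_mono) auto
    also have "\<dots> = c1 * \<rho>\<^sup>2 / 2"
      using pos by (simp add: field_simps)
    also have "\<dots> < c1 * \<rho>\<^sup>2"
      using pos assms(2) by simp
    finally show ?thesis .
  qed
  ultimately show ?thesis
    using local_solution_stays assms by blast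
qed

text \<open>A solution that never leaves the ball decays on the whole half-line, and
  \<open>lower\<close> transfers the decay from \<open>W\<close> to the distance.\<close>

lemma local_solution_tendsto:
  assumes x: "local_solution x" and start: "dist (x 0) xb < basin_radius r"
  shows "(x \<longlongrightarrow> xb) at_top"
proof -
  have ball: "dist (x t) xb \<le> r" if "t \<ge> 0" for t
    using stays_in_ball[OF x pos(1) order_refl start that] by simp
  have bound: "(dist (x t) xb)\<^sup>2 \<le> W (x 0) / c1 * exp (- (c3 / c2 * t))" if "t \<ge> 0" for t
  proof -
    have "c1 * (dist (x t) xb)\<^sup>2 \<le> W (x t)"
      using x lower ball that by (auto simp: local_solution_def)
    also have "\<dots> \<le> W (x 0) * exp (- (c3 / c2 * t))"
      using x that ball by (rule exponential_decay)
    finally show ?thesis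
      using pos by (simp add: field_simps)
  qed
  have "filterlim (\<lambda>t. c3 / c2 * t) at_top at_top"
    using pos by (intro filterlim_tendsto_pos_mult_at_top[OF tendsto_const _ filterlim_ident]) auto
  then have "((\<lambda>t. exp (- (c3 / c2 * t))) \<longlongrightarrow> 0) at_top"
    by (intro filterlim_compose[OF exp_at_bot]) (simp add: filterlim_uminus_at_bot)
  then have lim: "((\<lambda>t. W (x 0) / c1 * exp (- (c3 / c2 * t))) \<longlongrightarrow> 0) at_top"
    by (rule tendsto_mult_right_zero)
  have "((\<lambda>t. (dist (x t) xb)\<^sup>2) \<longlongrightarrow> 0) at_top"
  proof (rule tendsto_sandwich[OF _ _ tendsto_const lim])
    show "\<forall>\<^sub>F t in at_top. (dist (x t) xb)\<^sup>2 \<le> W (x 0) / c1 * exp (- (c3 / c2 * t))"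
      using eventually_ge_at_top[of 0] by (rule eventually_mono) (rule bound)
  qed simp
  then have "((\<lambda>t. sqrt ((dist (x t) xb)\<^sup>2)) \<longlongrightarrow> sqrt 0) at_top"
    by (rule tendsto_real_sqrt)
  then show ?thesis
    by (subst tendsto_dist_iff) simp
qed

end

section \<open>Existence of motions and asymptotic stability on a subspace\<close>

text \<open>The inner product of \<open>x t\<close> with any vector orthogonal to \<open>X\<close>
  has derivative zero and starts at zero; the double orthogonal complement of \<open>X\<close> is
  \<open>X\<close>.\<close>

lemma subspace_invariant:
  fixes x :: "real \<Rightarrow> 'a::euclidean_space"
  assumes X: "subspace X" and x0: "x 0 \<in> X"
    and x: "\<And>t. t \<ge> 0 \<Longrightarrow> (x has_vector_derivative x' t) (at t within {0..})"
    and x': "\<And>t. t \<ge> 0 \<Longrightarrow> x' t \<in> X" and "t \<ge> 0"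
  shows "x t \<in> X"
proof -
  have "u \<bullet> x t = 0" if u: "u \<in> X\<^sup>\<bottom>" for u
  proof -
    have perp: "u \<bullet> v = 0" if "v \<in> X" for v
      using u that by (auto simp: orthogonal_comp_def orthogonal_def inner_commute)
    have "((\<lambda>t. u \<bullet> x t) has_derivative (\<lambda>h. 0)) (at s within {0..})" if "s \<in> {0..}" for s
    proof -
      have "((\<lambda>t. u \<bullet> x t) has_derivative (\<lambda>h. u \<bullet> (h *\<^sub>R x' s))) (at s within {0..})"
        using x[of s] that unfolding has_vector_derivative_def
        by (intro has_derivative_inner_right) auto
      then show ?thesis
        using perp[OF x'[of s]] that by simp
    qed
    then obtain c where "\<And>s. s \<in> {0..} \<Longrightarrow> u \<bullet> x s = c"
      using has_derivative_zero_constant[of "{0..}" "\<lambda>t. u \<bullet> x t"] by auto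
    then show ?thesis
      using perp[OF x0] \<open>t \<ge> 0\<close> by (metis atLeast_iff order_refl)
  qed
  then have "x t \<in> X\<^sup>\<bottom>\<^sup>\<bottom>"
    by (auto simp: orthogonal_comp_def orthogonal_def)
  then show ?thesis
    using X by (simp add: orthogonal_comp_self)
qed

context strict_lyapunov
begin

text \<open>Precomposing \<open>F\<close> with the projection onto \<open>X \<inter> cball xb r\<close> gives a globally Lipschitz field
  that agrees with \<open>F\<close> where the solution stays.\<close>

theorem asymptotically_stable:
  assumes X: "subspace X" "xb \<in> X" and FX: "\<And>z. z \<in> X \<Longrightarrow> dist z xb \<le> r \<Longrightarrow> F z \<in> X"
    and F: "L-lipschitz_on (X \<inter> cball xb r) F"
    and lam: "\<And>z. z \<in> X \<Longrightarrow> dist z xb \<le> r \<Longrightarrow> lam z \<ge> 0"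
  shows "asymptotically_stable (motion F X lam) X xb"
  unfolding asymptotically_stable_def
  unfolding asymptotically_stable_def
proof (intro conjI)
  let ?B = "X \<inter> cball xb r"
  have B: "convex ?B" "closed ?B" "?B \<noteq> {}"
    using X pos by (auto intro: convex_Int subspace_imp_convex closed_Int closed_subspace)
  have proj: "closest_point ?B z \<in> ?B" for z
    using B by (intro closest_point_in_set)
  \<comment> \<open>Projection onto a closed convex set is nonexpansive, so the constant
    \<open>L\<close> is kept.\<close>
  have "L-lipschitz_on UNIV (F \<circ> closest_point ?B)"
  proof (rule lipschitz_onI)
    show L: "0 \<le> L"
      using F by (rule lipschitz_on_nonneg)
    fix y z
    have "dist (F (closest_point ?B y)) (F (closest_point ?B z))
        \<le> L * dist (closest_point ?B y) (closest_point ?B z)"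
      by (rule lipschitz_onD[OF F proj proj])
    also have "\<dots> \<le> L * dist y z"
      using closest_point_lipschitz[OF B] L by (intro mult_left_mono)
    finally show "dist ((F \<circ> closest_point ?B) y) ((F \<circ> closest_point ?B) z) \<le> L * dist y z"
      by simp
  qed
  note G = this
  show "well_posed_near (motion F X lam) X xb"
    unfolding well_posed_near_def
  proof (intro exI[of _ "basin_radius r"] conjI ballI impI)
    show "basin_radius r > 0"
      using pos(1) by (rule basin_radius_pos)
    fix x0 assume x0: "x0 \<in> X" "dist x0 xb < basin_radius r"
    obtain x where x: "x 0 = x0" "\<And>t. t \<ge> 0 \<Longrightarrow>
        (x has_vector_derivative (F \<circ> closest_point ?B) (x t)) (at t within {0..})"
      using lipschitz_global_solution[OF G] by metis
    \<comment> \<open>The truncated field takes values in \<open>X\<close> everywhere, even where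
      \<open>x t\<close> is not yet known to be near \<open>xb\<close>.\<close>
    have xX: "x t \<in> X" if "t \<ge> 0" for t
      using X(1) _ x(2) _ that
    proof (rule subspace_invariant)
      show "x 0 \<in> X"
        using x x0 by simp
      show "(F \<circ> closest_point ?B) (x t) \<in> X" for t
        using FX proj[of "x t"] by (auto simp: dist_commute)
    qed
    have F_eq: "(F \<circ> closest_point ?B) (x t) = F (x t)" if "t \<ge> 0" "dist (x t) xb \<le> r" for t
      using that xX by (simp add: closest_point_self dist_commute)
    have sol: "local_solution x"
      unfolding local_solution_def continuous_on_eq_continuous_within
      using x(2) xX F_eq has_vector_derivative_continuous by fastforce
    have "dist (x t) xb \<le> r" if "t \<ge> 0" for t
      using stays_in_ball[OF sol pos(1) order_refl _ that] x x0 by simp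
    then have "motion F X lam x"
      unfolding motion_def using x(2) xX F_eq lam by fastforce
    then show "\<exists>x. motion F X lam x \<and> x 0 = x0"
      using x by blast
  qed
  show "lyapunov_stable (motion F X lam) xb"
    unfolding lyapunov_stable_def
  proof (intro allI impI)
    fix e :: real assume "e > 0"
    then have \<rho>: "0 < min e r" "min e r \<le> r"
      using pos by auto
    show "\<exists>d>0. \<forall>x. motion F X lam x \<and> dist (x 0) xb < d \<longrightarrow> (\<forall>t\<ge>0. dist (x t) xb < e)"
      using basin_radius_pos[OF \<rho>(1)] stays_in_ball[OF motion_local_solution \<rho>]
      by (intro exI[of _ "basin_radius (min e r)"]) auto
  qed
  show "locally_attractive (motion F X lam) xb"
    unfolding locally_attractive_def
    using basin_radius_pos[OF pos(1)] local_solution_tendsto[OF motion_local_solution]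
    by (intro exI[of _ "basin_radius r"]) auto
qed

end

subsection \<open>Matrices and the horizontal projection\<close>

text \<open>The constant is the minimum of the quadratic form on the compact unit sphere;
  homogeneity of degree two extends the bound to all vectors.\<close>

lemma pos_def_coercive:
  fixes A :: "real^'n^'n"
  assumes "pos_def A"
  obtains c where "c > 0" "\<And>v. c * (norm v)\<^sup>2 \<le> v \<bullet> (A *v v)"
proof -
  have "continuous_on (sphere 0 1) (\<lambda>v. v \<bullet> (A *v v))"
    by (intro continuous_intros)
  moreover have "sphere (0::real^'n) 1 \<noteq> {}"
    by simp
  ultimately obtain u where u: "u \<in> sphere 0 1"
      "\<And>v. v \<in> sphere 0 1 \<Longrightarrow> u \<bullet> (A *v u) \<le> v \<bullet> (A *v v)"
    using continuous_attains_inf[OF compact_sphere, of "0::real^'n" 1] by blast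
  show thesis
  proof
    show "u \<bullet> (A *v u) > 0"
      using assms u(1) unfolding pos_def_def by (metis norm_zero mem_sphere_0 zero_neq_one)
    fix v :: "real^'n"
    show "(u \<bullet> (A *v u)) * (norm v)\<^sup>2 \<le> v \<bullet> (A *v v)"
    proof (cases "v = 0")
      case False
      then have "u \<bullet> (A *v u) \<le> (v /\<^sub>R norm v) \<bullet> (A *v (v /\<^sub>R norm v))"
        by (intro u(2)) simp
      also have "\<dots> = (v \<bullet> (A *v v)) / (norm v)\<^sup>2"
        by (simp add: matrix_vector_mult_scaleR power2_eq_square field_simps)
      finally show ?thesis
        using False by (simp add: field_simps)
    qed simp
  qed
qed

lemma matrix_vector_norm_bound:
  fixes A :: "real^'n^'m"
  obtains C where "C > 0" "\<And>v. norm (A *v v) \<le> C * norm v"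
  using bounded_linear.pos_bounded[OF matrix_vector_mul_bounded_linear[of A]]
  by (metis mult.commute)

text \<open>A positive definite matrix has trivial kernel, so an inverse exists and the choice in
  \<open>matrix_inv\<close> finds it.\<close>

lemma pos_def_matrix_inv:
  fixes A :: "real^'n^'n"
  assumes "pos_def A"
  shows "A *v (matrix_inv A *v v) = v"
proof -
  have "\<forall>v. A *v v = 0 \<longrightarrow> v = 0"
    using assms unfolding pos_def_def by (metis inner_zero_right less_irrefl)
  then have "invertible A"
    by (simp add: invertible_left_inverse matrix_left_invertible_ker)
  then have "\<exists>B. A ** B = mat 1 \<and> B ** A = mat 1"
    by (simp add: invertible_def)
  then have "A ** matrix_inv A = mat 1"
    unfolding matrix_inv_def by (rule someI2_ex) simp
  then show ?thesis
    by (simp add: matrix_vector_mul_assoc)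
qed

lemma diagonal_inner_commute:
  fixes A :: "real^'n^'n"
  assumes "is_diagonal A"
  shows "(A *v u) \<bullet> v = u \<bullet> (A *v v)"
proof -
  have "transpose A = A"
    using assms unfolding is_diagonal_def transpose_def vec_eq_iff by (metis vec_lambda_beta)
  then show ?thesis
    by (metis dot_lmul_matrix vector_transpose_matrix)
qed

section \<open>Vertical and horizontal components\<close>

lemma norm_z_W [simp]: "norm z_W = 1" and inner_z_W [simp]: "z_W \<bullet> z_W = 1"
  by (simp_all add: z_W_def inner_axis_axis)

text \<open>Orthogonal projection onto the ground plane. It expresses both the effect of the ground
  reaction and the feedback matrix \<open>K_H\<close>.\<close>

definition horiz :: "real^3 \<Rightarrow> real^3" where
  "horiz u = u - (z_W \<bullet> u) *\<^sub>R z_W"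

lemma linear_horiz: "linear horiz"
  by (rule linearI) (simp_all add: horiz_def inner_add_right algebra_simps)

lemma inner_z_horiz [simp]: "z_W \<bullet> horiz u = 0"
  by (simp add: horiz_def inner_diff_right)

lemma horiz_inner_commute: "horiz u \<bullet> v = u \<bullet> horiz v"
  by (simp add: horiz_def inner_diff_left inner_diff_right inner_commute)

lemma horiz_eq: "z_W \<bullet> u = 0 \<Longrightarrow> horiz u = u"
  by (simp add: horiz_def)

lemma norm_horiz: "(norm u)\<^sup>2 = (norm (horiz u))\<^sup>2 + (z_W \<bullet> u)\<^sup>2"
  unfolding power2_norm_eq_inner horiz_def
  by (simp add: inner_diff_left inner_diff_right inner_commute power2_eq_square)

lemma norm_horiz_le: "norm (horiz u) \<le> norm u"
  by (rule power2_le_imp_le) (simp_all add: norm_horiz[of u])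

lemma diag_horiz: "diag (vector [k, k, 0]) *v u = k *\<^sub>R horiz u"
  by (simp add: vec_eq_iff forall_3 matrix_vector_mult_def sum_3 diag_def horiz_def z_W_def
      inner_axis' vector_3) (simp add: axis_def)

subsection \<open>The taut cable\<close>

text \<open>The boundary case \<open>norm l = lb\<close> is included, as both sides vanish
  there.\<close>

lemma cable_force_taut:
  assumes "lb > 0" "norm l \<ge> lb"
  shows "cable_force k lb l = (k * (1 - lb / norm l)) *\<^sub>R l"
proof -
  have "norm l > 0"
    using assms by linarith
  then show ?thesis
    using assms by (auto simp: cable_force_def tension_def field_simps)
qed

text \<open>The taut force is \<open>k *\<^sub>R l\<close> minus \<open>k * lb\<close> times the
  unit vector along \<open>l\<close>. Normalization has Lipschitz constant \<open>1 / lb\<close>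
  outside the ball of radius \<open>lb\<close>, so each part contributes \<open>k\<close>.\<close>

lemma cable_force_lipschitz:
  assumes "k > 0" "lb > 0"
  shows "(2 * k)-lipschitz_on {l. lb \<le> norm l} (cable_force k lb)"
proof (rule lipschitz_onI)
  fix x y :: "real^3" assume "x \<in> {l. lb \<le> norm l}" "y \<in> {l. lb \<le> norm l}"
  then have xy: "lb \<le> norm x" "lb \<le> norm y"
    by auto
  then have pos: "norm x > 0" "norm y > 0"
    using assms by linarith+
  define u where "u = (1 / norm x) *\<^sub>R x - (1 / norm y) *\<^sub>R y"
  have xy_inner: "(norm (v - w))\<^sup>2 = (norm v)\<^sup>2 + (norm w)\<^sup>2 - 2 * (v \<bullet> w)" for v w :: "real^3"
    using dot_norm_neg[of v w] by simp
  have "(norm u)\<^sup>2 = 2 - 2 * (x \<bullet> y) / (norm x * norm y)"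
    using pos unfolding u_def xy_inner by simp
  then have "norm x * norm y * (norm u)\<^sup>2 = 2 * (norm x * norm y) - 2 * (x \<bullet> y)"
    using pos by (simp add: field_simps)
  also have "\<dots> \<le> (norm (x - y))\<^sup>2"
    using zero_le_power2[of "norm x - norm y"] by (simp add: xy_inner power2_diff)
  finally have "norm x * norm y * (norm u)\<^sup>2 \<le> (norm (x - y))\<^sup>2" .
  moreover have "lb * lb * (norm u)\<^sup>2 \<le> norm x * norm y * (norm u)\<^sup>2"
    using xy assms by (intro mult_right_mono mult_mono) auto
  ultimately have "(lb * norm u)\<^sup>2 \<le> (norm (x - y))\<^sup>2"
    by (simp add: power_mult_distrib flip: power2_eq_square)
  then have u: "lb * norm u \<le> norm (x - y)"
    by (rule power2_le_imp_le) simp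
  have "cable_force k lb x - cable_force k lb y = k *\<^sub>R (x - y) - (k * lb) *\<^sub>R u"
    using xy assms by (simp add: cable_force_taut u_def algebra_simps)
  also have "norm \<dots> \<le> k * norm (x - y) + k * (lb * norm u)"
    using norm_triangle_ineq4[of "k *\<^sub>R (x - y)" "(k * lb) *\<^sub>R u"] assms by (simp add: mult_ac)
  also have "\<dots> \<le> k * norm (x - y) + k * norm (x - y)"
    using u assms by (intro add_left_mono mult_left_mono) auto
  finally show "dist (cable_force k lb x) (cable_force k lb y) \<le> 2 * k * dist x y"
    by (simp add: dist_norm)
qed (use assms in simp)

text \<open>The last term is the potential of the constant reference force \<open>k (L - lb) z_W\<close>; the
  constants make the potential and its gradient vanish at \<open>l = L z_W\<close>.\<close>

definition cable_potential :: "real \<Rightarrow> real \<Rightarrow> real \<Rightarrow> real^3 \<Rightarrow> real" where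
  "cable_potential k lb L l = k / 2 * (norm l - lb)\<^sup>2 - k / 2 * (L - lb)\<^sup>2
     - k * (L - lb) * (z_W \<bullet> l - L)"

text \<open>Splits the displacement into elongation, \<open>norm l - L\<close>, and tilt,
  \<open>norm l - z_W \<bullet> l\<close>. The potential is a combination of the same two
  quantities.\<close>

lemma cable_displacement:
  fixes l :: "real^3"
  shows "(norm (l - L *\<^sub>R z_W))\<^sup>2 = (norm l - L)\<^sup>2 + 2 * L * (norm l - z_W \<bullet> l)"
  using dot_norm_neg[of l "L *\<^sub>R z_W"]
  by (simp add: power_mult_distrib power2_diff inner_commute algebra_simps)

lemma cable_potential_eq:
  "cable_potential k lb L l
     = k / 2 * ((norm l - L)\<^sup>2 + 2 * (L - lb) * (norm l - z_W \<bullet> l))"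
  by (simp add: cable_potential_def power2_eq_square field_simps)

lemma inner_z_W_le: "z_W \<bullet> l \<le> norm l"
  using norm_cauchy_schwarz[of z_W l] by simp

text \<open>Potential and squared displacement weigh the elongation alike up to
  \<open>k / 2\<close>; their tilt coefficients have the further ratio \<open>1 - lb / L\<close>,
  which lies between 0 and 1.\<close>

lemma cable_potential_bounds:
  fixes l :: "real^3"
  assumes "k > 0" "lb > 0" "L > lb"
  shows "k / 2 * (1 - lb / L) * (norm (l - L *\<^sub>R z_W))\<^sup>2 \<le> cable_potential k lb L l"
    and "cable_potential k lb L l \<le> k / 2 * (norm (l - L *\<^sub>R z_W))\<^sup>2"
proof -
  let ?D = "norm l - z_W \<bullet> l"
  have D: "?D \<ge> 0"
    using inner_z_W_le[of l] by simp
  have "(1 - lb / L) * L = L - lb"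
    using assms by (simp add: field_simps)
  then have "(1 - lb / L) * ((norm l - L)\<^sup>2 + 2 * L * ?D)
      = (1 - lb / L) * (norm l - L)\<^sup>2 + 2 * (L - lb) * ?D"
    by algebra
  also have "\<dots> \<le> (norm l - L)\<^sup>2 + 2 * (L - lb) * ?D"
    using assms by (intro add_right_mono mult_left_le_one_le) auto
  finally have "k / 2 * ((1 - lb / L) * ((norm l - L)\<^sup>2 + 2 * L * ?D))
      \<le> k / 2 * ((norm l - L)\<^sup>2 + 2 * (L - lb) * ?D)"
    using assms by (intro mult_left_mono) auto
  then show "k / 2 * (1 - lb / L) * (norm (l - L *\<^sub>R z_W))\<^sup>2 \<le> cable_potential k lb L l"
    unfolding cable_displacement cable_potential_eq by (simp add: mult.assoc)
  show "cable_potential k lb L l \<le> k / 2 * (norm (l - L *\<^sub>R z_W))\<^sup>2"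
    unfolding cable_displacement cable_potential_eq
    using assms D by (intro mult_left_mono add_left_mono mult_right_mono) auto
qed

text \<open>The restoring effect of the cable, which makes the cross term of the Lyapunov function
  decrease in the displacement. The tilt term subtracted from the squared displacement is at most
  the fraction \<open>(1 + lb / L) / 2\<close> of it, because \<open>lb / n \<le> 1\<close>.\<close>

lemma cable_force_monotone:
  fixes l :: "real^3"
  assumes "k > 0" "lb > 0" "L > lb" "norm l \<ge> lb"
  shows "k / 2 * (1 - lb / L) * (norm (l - L *\<^sub>R z_W))\<^sup>2
    \<le> (cable_force k lb l - (k * (L - lb)) *\<^sub>R z_W) \<bullet> (l - L *\<^sub>R z_W)"
proof -
  define n c where "n = norm l" and "c = z_W \<bullet> l"
  have n: "n \<ge> lb" "n > 0" and D: "n - c \<ge> 0"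
    using assms inner_z_W_le[of l] by (auto simp: n_def c_def)
  have ll: "l \<bullet> l = n * n"
    by (simp add: n_def power2_eq_square flip: power2_norm_eq_inner)
  have "(cable_force k lb l - (k * (L - lb)) *\<^sub>R z_W) \<bullet> (l - L *\<^sub>R z_W)
      = k * (1 - lb / n) * (n * n - L * c) - k * (L - lb) * (c - L)"
    using assms
    by (simp add: cable_force_taut inner_diff_left inner_diff_right ll inner_commute[of l z_W]
        flip: n_def c_def) (simp add: algebra_simps)
  also have "\<dots> = k * (((n - L)\<^sup>2 + 2 * L * (n - c)) - lb * (1 + L / n) * (n - c))"
    using n by (simp add: field_simps power2_eq_square)
  finally have eq: "(cable_force k lb l - (k * (L - lb)) *\<^sub>R z_W) \<bullet> (l - L *\<^sub>R z_W)
      = k * (((n - L)\<^sup>2 + 2 * L * (n - c)) - lb * (1 + L / n) * (n - c))" .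
  have "lb * (1 + L / n) \<le> L + lb"
  proof -
    have "lb / n \<le> 1"
      using n assms by simp
    then have "L * (lb / n) \<le> L"
      using assms by (intro mult_left_le) auto
    then show ?thesis
      by (simp add: algebra_simps)
  qed
  then have "lb * (1 + L / n) * (n - c) \<le> (L + lb) * (n - c)"
    using D by (rule mult_right_mono)
  also have "\<dots> \<le> 1 / 2 * (1 + lb / L) * ((n - L)\<^sup>2 + 2 * L * (n - c))"
  proof -
    have "0 \<le> 1 / 2 * (1 + lb / L) * (n - L)\<^sup>2"
      using assms by simp
    moreover have "1 / 2 * (1 + lb / L) * (2 * L * (n - c)) = (L + lb) * (n - c)"
      using assms by (simp add: field_simps)
    ultimately show ?thesis
      unfolding distrib_left[of _ "(n - L)\<^sup>2"] by linarith
  qed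
  finally have half: "lb * (1 + L / n) * (n - c)
      \<le> 1 / 2 * (1 + lb / L) * ((n - L)\<^sup>2 + 2 * L * (n - c))" .
  have "1 / 2 * (1 - q) * p = p - 1 / 2 * (1 + q) * p" for p q :: real
    by (simp add: field_simps)
  with half have "1 / 2 * (1 - lb / L) * ((n - L)\<^sup>2 + 2 * L * (n - c))
      \<le> ((n - L)\<^sup>2 + 2 * L * (n - c)) - lb * (1 + L / n) * (n - c)"
    by simp
  then have "k * (1 / 2 * (1 - lb / L) * ((n - L)\<^sup>2 + 2 * L * (n - c)))
      \<le> k * (((n - L)\<^sup>2 + 2 * L * (n - c)) - lb * (1 + L / n) * (n - c))"
    using assms by (intro mult_left_mono) auto
  then show ?thesis
    unfolding eq cable_displacement n_def[symmetric] c_def[symmetric] by (simp add: mult_ac)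
qed

text \<open>The potential is not cut off at slackness, so it is differentiable also at
  \<open>norm l = lb\<close>, where its gradient still matches the cable force.\<close>

lemma cable_potential_has_derivative:
  assumes "lb > 0" "norm l \<ge> lb"
  shows "(cable_potential k lb L has_derivative
     (\<lambda>h. (cable_force k lb l - (k * (L - lb)) *\<^sub>R z_W) \<bullet> h)) (at l)"
proof -
  have "norm l > 0"
    using assms by linarith
  then have "l \<noteq> 0"
    by auto
  have "(cable_potential k lb L has_derivative
      (\<lambda>h. k * (norm l - lb) * (h \<bullet> sgn l) - k * (L - lb) * (z_W \<bullet> h))) (at l)"
    unfolding cable_potential_def[abs_def]
    by (rule derivative_eq_intros has_derivative_norm refl \<open>l \<noteq> 0\<close>)+
      (simp add: inner_commute mult_ac)
  moreover have "k * (norm l - lb) * (h \<bullet> sgn l) - k * (L - lb) * (z_W \<bullet> h)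
      = (cable_force k lb l - (k * (L - lb)) *\<^sub>R z_W) \<bullet> h" for h
  proof -
    have "(norm l - lb) * (h \<bullet> sgn l) = (1 - lb / norm l) * (l \<bullet> h)"
      using \<open>norm l > 0\<close> by (simp add: sgn_div_norm inner_commute[of h l] field_simps)
    then show ?thesis
      using assms by (simp add: cable_force_taut inner_diff_left)
  qed
  ultimately show ?thesis
    by simp
qed

subsection \<open>The closed-loop system\<close>

text \<open>For horizontal \<open>a\<close>, the vertical part of \<open>b\<close> is visible in
  \<open>b - a\<close>. This is how the ground constraint excludes a common vertical translation of
  human and robot.\<close>

lemma horiz_split_bound:
  assumes "z_W \<bullet> a = 0"
  shows "(norm a)\<^sup>2 + (norm b)\<^sup>2 \<le> 3 * ((norm (b - a))\<^sup>2 + (norm (horiz b))\<^sup>2)"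
proof -
  have "z_W \<bullet> b = z_W \<bullet> (b - a)"
    using assms by (simp add: inner_diff_right)
  then have "(z_W \<bullet> b)\<^sup>2 \<le> (norm (b - a))\<^sup>2"
    using norm_horiz[of "b - a"] by simp
  then have b: "(norm b)\<^sup>2 \<le> (norm (horiz b))\<^sup>2 + (norm (b - a))\<^sup>2"
    using norm_horiz[of b] by simp
  have "a = horiz b - horiz (b - a)"
    using assms by (simp add: linear_diff[OF linear_horiz] horiz_eq)
  then have "norm a \<le> norm (horiz b) + norm (b - a)"
    using norm_triangle_ineq4[of "horiz b" "horiz (b - a)"] norm_horiz_le[of "b - a"] by simp
  then have "(norm a)\<^sup>2 \<le> (norm (horiz b) + norm (b - a))\<^sup>2"
    by (intro power_mono) auto
  also have "\<dots> \<le> 2 * (norm (horiz b))\<^sup>2 + 2 * (norm (b - a))\<^sup>2"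
    using sum_squares_bound[of "norm (horiz b)" "norm (b - a)"] by (simp add: power2_sum)
  finally show ?thesis
    using b by simp
qed

lemma weighted_young:
  fixes x y :: real
  assumes "e > 0"
  shows "C * x * y \<le> e / 2 * x\<^sup>2 + C\<^sup>2 / (2 * e) * y\<^sup>2"
proof -
  have "0 \<le> (e * x - C * y)\<^sup>2 / (2 * e)"
    using assms by simp
  also have "\<dots> = e / 2 * x\<^sup>2 + C\<^sup>2 / (2 * e) * y\<^sup>2 - C * x * y"
    using assms by (simp add: power2_eq_square field_simps)
  finally show ?thesis
    by simp
qed

lemma isCont_eventually_greater:
  fixes f :: "'a::t2_space \<Rightarrow> real"
  shows "isCont f x \<Longrightarrow> c < f x \<Longrightarrow> \<forall>\<^sub>F y in nhds x. c < f y"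
  unfolding isCont_def tendsto_at_iff_tendsto_nhds by (rule order_tendstoD(1))

lemma linear_lipschitzE:
  fixes f :: "'a::euclidean_space \<Rightarrow> 'b::real_normed_vector"
  assumes "linear f"
  obtains C where "C-lipschitz_on X f"
proof -
  have "bounded_linear f"
    using assms by (simp add: linear_conv_bounded_linear)
  then show thesis
    using that by (rule bounded_linear.lipschitz_boundE)
qed

section \<open>Closed-loop field, equilibrium and the taut neighbourhood\<close>

locale tethered_robot =
  fixes m g k lb kH fz :: real and B M A K :: "real^3^3" and pr qr fr :: "real^3"
    and F :: "state \<Rightarrow> state" and xb :: state
  assumes pos: "m > 0" "k > 0" "lb > 0" "kH > 0" "0 < fz"
    and weight: "fz < m * g"
    and B: "pos_def B" and M: "pos_def M" "is_diagonal M" and A: "pos_def A"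
    and K: "K = diag (vector [kH, kH, 0])"
    and pr: "z_W \<bullet> pr = 0" and fr: "fr = force_ref fz" and qr: "qr = robot_ref k lb pr fr"
    and F: "F = (\<lambda>x. system_field m g k lb B M A (control K qr fr x) x)"
    and xb: "xb = (pr, 0, qr, 0)"
begin

text \<open>The cable length at equilibrium, at which the tension equals \<open>fz\<close>.\<close>

definition L :: real where
  "L = lb + fz / k"

lemma L: "L > lb" "k * (L - lb) = fz" "qr - pr = L *\<^sub>R z_W"
  using pos by (auto simp: L_def qr robot_ref_def fr force_ref_def field_simps)

lemma norm_cable_ref: "norm (qr - pr) = L"
  using L pos by simp

abbreviation force :: "real^3 \<Rightarrow> real^3" where
  "force l \<equiv> cable_force k lb l"

definition force_dev :: "real^3 \<Rightarrow> real^3" where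
  "force_dev l = force l - fz *\<^sub>R z_W"

lemma ground_intensity_eq:
  "ground_intensity m g k lb B (p, w, q, v) = m * g + z_W \<bullet> (B *v w) - z_W \<bullet> force (q - p)"
  unfolding ground_intensity_def
proof (rule the_equality)
  have acc: "z_W \<bullet> human_acc m g k lb B lam (p, w, q, v)
      = (1 / m) * (- (m * g) - z_W \<bullet> (B *v w) + z_W \<bullet> force (q - p) + lam)" for lam
    by (simp add: human_acc_def inner_add_right inner_diff_right)
  show "z_W \<bullet> human_acc m g k lb B (m * g + z_W \<bullet> (B *v w) - z_W \<bullet> force (q - p)) (p, w, q, v) = 0"
    unfolding acc by simp
  show "lam = m * g + z_W \<bullet> (B *v w) - z_W \<bullet> force (q - p)"
    if "z_W \<bullet> human_acc m g k lb B lam (p, w, q, v) = 0" for lam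
    using that pos unfolding acc by simp
qed

text \<open>The ground reaction cancels the vertical forces on the human, leaving a projection; the
  reference force in the control turns the cable force on the robot into
  \<open>force_dev\<close>.\<close>

lemma F_eq:
  "F (p, w, q, v) = (w, (1 / m) *\<^sub>R horiz (force (q - p) - B *v w), v,
     matrix_inv M *v (- (A *v v) - force_dev (q - p) - kH *\<^sub>R horiz (q - qr)))"
proof -
  have "human_acc m g k lb B (ground_intensity m g k lb B (p, w, q, v)) (p, w, q, v)
      = (1 / m) *\<^sub>R horiz (force (q - p) - B *v w)"
    by (simp add: human_acc_def ground_intensity_eq horiz_def inner_diff_right algebra_simps)
  moreover have "robot_acc k lb M A (control K qr fr (p, w, q, v)) (p, w, q, v)
      = matrix_inv M *v (- (A *v v) - force_dev (q - p) - kH *\<^sub>R horiz (q - qr))"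
  proof -
    have "horiz (qr - q) = - horiz (q - qr)"
      by (simp add: linear_diff[OF linear_horiz])
    then have "- (A *v v) - force (q - p) + control K qr fr (p, w, q, v)
        = - (A *v v) - force_dev (q - p) - kH *\<^sub>R horiz (q - qr)"
      by (simp add: control_def K diag_horiz fr force_ref_def force_dev_def)
    then show ?thesis
      by (simp only: robot_acc_def prod.case)
  qed
  ultimately show ?thesis
    by (simp add: F system_field_def)
qed

lemma F_state_space: "x \<in> state_space \<Longrightarrow> F x \<in> state_space"
  by (cases x) (simp add: F_eq state_space_def)

lemma subspace_state_space: "subspace state_space"
  by (rule subspaceI) (auto simp: state_space_def zero_prod_def inner_add_right)

lemma xb_state_space: "xb \<in> state_space"
  by (simp add: xb state_space_def pr)

lemma equilibrium_xb: "equilibrium F state_space xb"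
proof -
  have "force (qr - pr) = fz *\<^sub>R z_W"
    using pos L norm_cable_ref by (simp add: cable_force_taut field_simps)
  then show ?thesis
    using linear_0[OF linear_horiz]
    by (simp add: equilibrium_def xb_state_space)
      (simp add: xb F_eq force_dev_def linear_cmul[OF linear_horiz] zero_prod_def horiz_def)
qed

text \<open>The field is a linear map, plus a linear image of the cable force, plus a constant; only
  the cable force needs tautness.\<close>

lemma F_lipschitz: obtains C where "C-lipschitz_on {(p, w, q, v). lb \<le> norm (q - p)} F"
proof -
  define F1 where "F1 = (\<lambda>(p :: real^3, w, q, v). (w, - (1 / m) *\<^sub>R horiz (B *v w), v,
      matrix_inv M *v (- (A *v v) - kH *\<^sub>R horiz q)))"
  define F2 where "F2 = (\<lambda>f. (0::real^3, (1 / m) *\<^sub>R horiz f, 0::real^3, matrix_inv M *v (- f)))"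
  define c where "c = (0::real^3, 0::real^3, 0::real^3,
      matrix_inv M *v (fz *\<^sub>R z_W + kH *\<^sub>R horiz qr))"
  let ?l = "(\<lambda>(p, w, q, v). q - p) :: state \<Rightarrow> real^3"
  have F_sum: "F x = F1 x + F2 (force (?l x)) + c" for x
    by (cases x) (auto simp: F_eq F1_def F2_def c_def force_dev_def linear_diff[OF linear_horiz]
        algebra_simps simp flip: matrix_vector_right_distrib matrix_vector_mult_scaleR
        intro!: arg_cong[where f = "(*v) (matrix_inv M)"])
  have "linear F1"
    unfolding F1_def
    by (rule linearI) (auto simp: linear_add[OF linear_horiz] linear_cmul[OF linear_horiz]
        matrix_vector_right_distrib matrix_vector_mult_diff_distrib matrix_vector_mult_scaleR
        linear_neg[OF matrix_vector_mul_linear] algebra_simps)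
  then obtain C1 where C1: "C1-lipschitz_on UNIV F1"
    by (rule linear_lipschitzE[where X = UNIV])
  have "linear F2"
    unfolding F2_def
    by (rule linearI) (simp_all add: linear_add[OF linear_horiz] linear_cmul[OF linear_horiz]
        matrix_vector_mult_diff_distrib matrix_vector_mult_scaleR
        linear_neg[OF matrix_vector_mul_linear] matrix_vector_right_distrib algebra_simps)
  then obtain C2 where C2: "C2-lipschitz_on UNIV F2"
    by (rule linear_lipschitzE[where X = UNIV])
  have "linear ?l"
    by (rule linearI) (auto simp: algebra_simps)
  then obtain C3 where C3: "C3-lipschitz_on UNIV ?l"
    by (rule linear_lipschitzE[where X = UNIV])
  let ?S = "{(p, w, q, v). lb \<le> norm (q - p)} :: state set"
  have "(C2 * (2 * k * C3))-lipschitz_on ?S (\<lambda>x. F2 (force (?l x)))"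
    using pos
    by (intro lipschitz_on_compose2 lipschitz_on_subset[OF C2] lipschitz_on_subset[OF C3]
        lipschitz_on_subset[OF cable_force_lipschitz]) auto
  then have "(C1 + C2 * (2 * k * C3) + 0)-lipschitz_on ?S (\<lambda>x. F1 x + F2 (force (?l x)) + c)"
    by (intro lipschitz_on_add lipschitz_on_constant lipschitz_on_subset[OF C1]) auto
  then show thesis
    using that by (simp flip: F_sum)
qed

text \<open>At \<open>xb\<close> the cable length is \<open>L > lb\<close> and the reaction is
  \<open>m * g - fz > 0\<close>; both strict inequalities persist nearby by continuity.\<close>

lemma good_neighbourhood:
  obtains r where "r > 0"
    "\<And>p w q v. dist (p, w, q, v) xb \<le> r \<Longrightarrow>
       lb \<le> norm (q - p) \<and> ground_intensity m g k lb B (p, w, q, v) \<ge> 0"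
proof -
  let ?l = "\<lambda>x :: state. fst (snd (snd x)) - fst x"
  \<comment> \<open>The reaction written with the taut formula, which is continuous at
    \<open>xb\<close> without a case distinction.\<close>
  let ?lam = "\<lambda>x :: state. m * g + z_W \<bullet> (B *v fst (snd x))
      - k * (1 - lb / norm (?l x)) * (z_W \<bullet> ?l x)"
  have l: "?l xb = L *\<^sub>R z_W" "norm (?l xb) = L"
    using L norm_cable_ref by (simp_all add: xb)
  have "isCont (\<lambda>x. norm (?l x)) xb"
    by (intro continuous_intros)
  then have taut: "\<forall>\<^sub>F x in nhds xb. lb < norm (?l x)"
    by (rule isCont_eventually_greater) (use l(2) L(1) in simp)
  have "isCont ?lam xb"
    using l(2) L(1) pos
    by (intro continuous_intros isCont_o2[OF _ matrix_vector_mult_linear_continuous_at]) auto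
  moreover have "?lam xb = m * g - fz"
    unfolding l using L pos by (simp add: xb field_simps)
  ultimately have "\<forall>\<^sub>F x in nhds xb. 0 < ?lam x"
    using isCont_eventually_greater[of xb ?lam 0] weight by simp
  with taut have "\<forall>\<^sub>F x in nhds xb. lb < norm (?l x) \<and> 0 < ?lam x"
    by (rule eventually_conj)
  then obtain d where d: "d > 0" "\<And>x. dist x xb < d \<Longrightarrow> lb < norm (?l x) \<and> 0 < ?lam x"
    unfolding eventually_nhds_metric by blast
  show thesis
  proof
    show "d / 2 > 0"
      using d by simp
    fix p w q v assume "dist (p, w, q, v) xb \<le> d / 2"
    then have "lb < norm (q - p)"
        "0 < m * g + z_W \<bullet> (B *v w) - k * (1 - lb / norm (q - p)) * (z_W \<bullet> (q - p))"
      using d(2)[of "(p, w, q, v)"] d(1) by auto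
    then show "lb \<le> norm (q - p) \<and> ground_intensity m g k lb B (p, w, q, v) \<ge> 0"
      using pos by (simp add: ground_intensity_eq cable_force_taut)
  qed
qed

text \<open>The energy is perturbed by \<open>\<epsilon>\<close> times a cross term between momentum and displacement, which
  makes its derivative negative definite; the energy alone dissipates only in the velocities.\<close>

definition lyapunov :: "real \<Rightarrow> state \<Rightarrow> real" where
  "lyapunov \<epsilon> = (\<lambda>(p, w, q, v).
     m / 2 * (w \<bullet> w) + 1 / 2 * (v \<bullet> (M *v v))
     + (cable_potential k lb L (q - p) + kH / 2 * (horiz (q - qr) \<bullet> horiz (q - qr)))
     + \<epsilon> * (m * (w \<bullet> (p - pr)) + (M *v v) \<bullet> (q - qr)))"

text \<open>The differential at a state, applied to a direction. \<open>force_dev\<close> is the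
  gradient of the cable potential, and the symmetric halves of each quadratic form are already
  merged.\<close>

definition lyapunov' :: "real \<Rightarrow> state \<Rightarrow> state \<Rightarrow> real" where
  "lyapunov' \<epsilon> = (\<lambda>(p, w, q, v) (dp, dw, dq, dv).
     m * (w \<bullet> dw) + (M *v v) \<bullet> dv
     + (force_dev (q - p) \<bullet> (dq - dp) + kH * (horiz (q - qr) \<bullet> dq))
     + \<epsilon> * (m * (w \<bullet> dp) + m * (dw \<bullet> (p - pr)) + (M *v v) \<bullet> dq + (M *v dv) \<bullet> (q - qr)))"

section \<open>Derivative of the Lyapunov function along the field\<close>

lemma lyapunov_has_derivative:
  assumes "z = (p, w, q, v)" "lb \<le> norm (q - p)"
  shows "(lyapunov \<epsilon> has_derivative lyapunov' \<epsilon> z) (at z)"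
proof -
  have mult: "((\<lambda>x. N *v f x) has_derivative (\<lambda>h. N *v f' h)) (at z)"
    if "(f has_derivative f') (at z)" for N :: "real^3^3" and f f'
    using that by (rule bounded_linear.has_derivative[OF matrix_vector_mul_bounded_linear])
  have hor: "((\<lambda>x. horiz (f x)) has_derivative (\<lambda>h. horiz (f' h))) (at z)"
    if "(f has_derivative f') (at z)" for f :: "state \<Rightarrow> real^3" and f'
    using that linear_horiz bounded_linear.has_derivative linear_conv_bounded_linear by blast
  let ?l = "\<lambda>x :: state. fst (snd (snd x)) - fst x"
  have "(?l has_derivative ?l) (at z)"
    by (intro derivative_intros)
  moreover have "(cable_potential k lb L has_derivative (\<lambda>h. force_dev (?l z) \<bullet> h)) (at (?l z))"
    using cable_potential_has_derivative[of lb "?l z" k L] assms pos L(2)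
    by (simp add: force_dev_def)
  ultimately have pot: "((\<lambda>x. cable_potential k lb L (?l x)) has_derivative
      (\<lambda>h. force_dev (?l z) \<bullet> ?l h)) (at z)"
    by (rule has_derivative_compose)
  \<comment> \<open>The product rule yields each quadratic form as two halves, which symmetry of
    \<open>M\<close> and of the projection merges.\<close>
  have eq: "m * (w \<bullet> dw) / 2 + (m * (dw \<bullet> w) / 2 + (v \<bullet> (M *v dv) / 2 + (dv \<bullet> (M *v v) / 2 +
        (kH * (horiz (q - qr) \<bullet> horiz dq) / 2 + kH * (horiz dq \<bullet> horiz (q - qr)) / 2))))
      = m * (w \<bullet> dw) + ((M *v v) \<bullet> dv + kH * (horiz (q - qr) \<bullet> dq))" for dw dq dv
  proof -
    have "v \<bullet> (M *v dv) = (M *v v) \<bullet> dv"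
      using diagonal_inner_commute[OF M(2)] by simp
    moreover have "horiz (q - qr) \<bullet> horiz dq = horiz (q - qr) \<bullet> dq"
      by (metis horiz_eq horiz_inner_commute inner_z_horiz)
    ultimately show ?thesis
      by (simp add: inner_commute[of dw] inner_commute[of dv] inner_commute[of "horiz dq"])
  qed
  show ?thesis
    unfolding lyapunov_def lyapunov'_def case_prod_beta'
    by (rule derivative_eq_intros mult hor pot refl)+
      (simp add: fun_eq_iff assms(1) eq distrib_left)
qed

text \<open>The powers of cable and feedback cancel against the change of potential energy, leaving
  the damping and the terms with \<open>\<epsilon>\<close>.\<close>

lemma lyapunov'_F:
  assumes z: "(p, w, q, v) \<in> state_space"
  shows "lyapunov' \<epsilon> (p, w, q, v) (F (p, w, q, v)) =
     - (w \<bullet> (B *v w)) - v \<bullet> (A *v v)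
     + \<epsilon> * (m * (norm w)\<^sup>2 + v \<bullet> (M *v v) - (p - pr) \<bullet> (B *v w) - (q - qr) \<bullet> (A *v v)
         - (force_dev (q - p) \<bullet> ((q - qr) - (p - pr)) + kH * (norm (horiz (q - qr)))\<^sup>2))"
proof -
  let ?f = "force_dev (q - p)"
  have w: "z_W \<bullet> w = 0" and p: "z_W \<bullet> (p - pr) = 0"
    using z pr by (auto simp: state_space_def inner_diff_right)
  \<comment> \<open>Against a horizontal vector the projection is invisible and the vertical
    reference force vanishes. This is applied to \<open>w\<close> and \<open>p - pr\<close>.\<close>
  have force: "u \<bullet> horiz (force (q - p) - B *v w) = u \<bullet> ?f - u \<bullet> (B *v w)" if "z_W \<bullet> u = 0" for u
  proof -
    have "u \<bullet> horiz (force (q - p) - B *v w) = u \<bullet> (force (q - p) - B *v w)"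
      using that by (metis horiz_eq horiz_inner_commute)
    then show ?thesis
      using that by (simp add: force_dev_def inner_diff_right inner_commute[of u z_W])
  qed
  define dv where "dv = matrix_inv M *v (- (A *v v) - ?f - kH *\<^sub>R horiz (q - qr))"
  have Mdv: "M *v dv = - (A *v v) - ?f - kH *\<^sub>R horiz (q - qr)"
    unfolding dv_def by (rule pos_def_matrix_inv[OF M(1)])
  have "(M *v v) \<bullet> dv = v \<bullet> (M *v dv)"
    using M by (simp add: diagonal_inner_commute)
  also have "\<dots> = - (v \<bullet> (A *v v)) - v \<bullet> ?f - kH * (v \<bullet> horiz (q - qr))"
    by (simp add: Mdv inner_diff_right)
  finally have vdv: "(M *v v) \<bullet> dv = - (v \<bullet> (A *v v)) - v \<bullet> ?f - kH * (v \<bullet> horiz (q - qr))" .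
  have hh: "horiz u \<bullet> u = (norm (horiz u))\<^sup>2" for u
    by (simp add: power2_norm_eq_inner) (metis horiz_eq horiz_inner_commute inner_z_horiz)
  define dw where "dw = (1 / m) *\<^sub>R horiz (force (q - p) - B *v w)"
  have dw: "m * (u \<bullet> dw) = u \<bullet> ?f - u \<bullet> (B *v w)" if "z_W \<bullet> u = 0" for u
    using force[OF that] pos by (simp add: dw_def)
  have "F (p, w, q, v) = (w, dw, v, dv)"
    by (simp add: F_eq dv_def dw_def)
  moreover have "m * (dw \<bullet> (p - pr)) = (p - pr) \<bullet> ?f - (p - pr) \<bullet> (B *v w)"
    using dw[OF p] by (simp only: inner_commute)
  moreover have "(M *v dv) \<bullet> (q - qr)
      = - ((q - qr) \<bullet> (A *v v)) - ?f \<bullet> (q - qr) - kH * (norm (horiz (q - qr)))\<^sup>2"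
    by (simp only: Mdv inner_diff_left inner_minus_left inner_scaleR_left hh
        inner_commute[of "A *v v"])
  ultimately show ?thesis
    unfolding lyapunov'_def
    by (simp add: vdv dw[OF w])
      (simp add: inner_diff_right inner_commute power2_norm_eq_inner algebra_simps)
qed


section \<open>Coercivity of the potential and choice of the constants\<close>

lemma dist_xb:
  "(dist (p, w, q, v) xb)\<^sup>2 = (norm (p - pr))\<^sup>2 + (norm w)\<^sup>2 + (norm (q - qr))\<^sup>2 + (norm v)\<^sup>2"
  by (simp add: xb dist_norm norm_Pair)

text \<open>The weaker of the feedback and cable constants, divided by the 3 of
  \<open>horiz_split_bound\<close>.\<close>

definition stiffness :: real where
  "stiffness = min (kH / 2) (k / 2 * (1 - lb / L)) / 3"

lemma stiffness_pos: "stiffness > 0"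
  using pos L(1) by (simp add: stiffness_def)

text \<open>The potential and the restoring term both dominate the same combination of cable
  displacement and horizontal robot displacement (\<open>low\<close>), so one constant serves for
  both.\<close>

lemma potential_bounds:
  fixes p q :: "real^3"
  assumes p: "z_W \<bullet> p = 0"
  defines "N \<equiv> (norm (p - pr))\<^sup>2 + (norm (q - qr))\<^sup>2"
    and "U \<equiv> cable_potential k lb L (q - p) + kH / 2 * (horiz (q - qr) \<bullet> horiz (q - qr))"
  shows "stiffness * N \<le> U" and "U \<le> (k + kH) * N"
    and "lb \<le> norm (q - p) \<Longrightarrow> stiffness * N
      \<le> force_dev (q - p) \<bullet> ((q - qr) - (p - pr)) + kH * (norm (horiz (q - qr)))\<^sup>2"
proof -
  let ?d = "(q - qr) - (p - pr)" and ?h = "horiz (q - qr)"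
  let ?D = "(norm ?d)\<^sup>2" and ?H = "(norm ?h)\<^sup>2"
  have d: "(q - p) - L *\<^sub>R z_W = ?d"
    by (simp flip: L(3))
  have "N \<le> 3 * (?D + ?H)"
    unfolding N_def using p pr by (intro horiz_split_bound) (simp add: inner_diff_right)
  then have "stiffness * N \<le> stiffness * (3 * (?D + ?H))"
    using stiffness_pos by (intro mult_left_mono) auto
  also have "\<dots> = min (kH / 2) (k / 2 * (1 - lb / L)) * ?D
      + min (kH / 2) (k / 2 * (1 - lb / L)) * ?H"
    by (simp add: stiffness_def distrib_left)
  also have "\<dots> \<le> k / 2 * (1 - lb / L) * ?D + kH / 2 * ?H"
    by (intro add_mono mult_right_mono min.cobounded1 min.cobounded2) auto
  finally have low: "stiffness * N \<le> k / 2 * (1 - lb / L) * ?D + kH / 2 * ?H" .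
  have U: "U = cable_potential k lb L (q - p) + kH / 2 * ?H"
    by (simp add: U_def power2_norm_eq_inner)
  note pot = cable_potential_bounds[OF pos(2,3) L(1), of "q - p", unfolded d]
  show "stiffness * N \<le> U"
    using low pot(1) U by linarith
  have "norm ?d \<le> norm (q - qr) + norm (p - pr)"
    by (rule norm_triangle_ineq4)
  then have "?D \<le> (norm (q - qr) + norm (p - pr))\<^sup>2"
    by (intro power_mono) auto
  also have "\<dots> \<le> 2 * N"
    using sum_squares_bound[of "norm (q - qr)" "norm (p - pr)"] by (simp add: N_def power2_sum)
  finally have "k / 2 * ?D \<le> k / 2 * (2 * N)"
    using pos by (intro mult_left_mono) auto
  moreover have "kH / 2 * ?H \<le> kH * N"
  proof -
    have "?H \<le> (norm (q - qr))\<^sup>2"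
      using norm_horiz_le by (intro power_mono) auto
    then have "?H \<le> N"
      by (simp add: N_def add_increasing)
    then show ?thesis
      using pos by (intro mult_mono) auto
  qed
  ultimately show "U \<le> (k + kH) * N"
    using pot(2) U by (simp add: distrib_right)
  show "stiffness * N \<le> force_dev (q - p) \<bullet> ?d + kH * ?H" if "lb \<le> norm (q - p)"
  proof -
    have "k / 2 * (1 - lb / L) * ?D \<le> force_dev (q - p) \<bullet> ?d"
      using cable_force_monotone[OF pos(2,3) L(1) that, unfolded d L(2)] by (simp add: force_dev_def)
    moreover have "kH / 2 * ?H \<le> kH * ?H"
      using pos by (intro mult_right_mono) auto
    ultimately show ?thesis
      using low by linarith
  qed
qed

text \<open>\<open>\<epsilon>\<close> is small in two respects: the cross term takes at most half of
  the lower bound on the energy, and the velocity terms in its derivative at most half of the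
  damping.\<close>

theorem strict_lyapunov_exists:
  obtains \<epsilon> r c1 c2 c3 where
    "strict_lyapunov F state_space xb (lyapunov \<epsilon>) (lyapunov' \<epsilon>) r c1 c2 c3"
    "\<And>p w q v. dist (p, w, q, v) xb \<le> r \<Longrightarrow>
       lb \<le> norm (q - p) \<and> ground_intensity m g k lb B (p, w, q, v) \<ge> 0"
proof -
  obtain r where r: "r > 0" "\<And>p w q v. dist (p, w, q, v) xb \<le> r \<Longrightarrow>
       lb \<le> norm (q - p) \<and> ground_intensity m g k lb B (p, w, q, v) \<ge> 0"
    using good_neighbourhood by blast
  obtain bB where bB: "bB > 0" "\<And>w. bB * (norm w)\<^sup>2 \<le> w \<bullet> (B *v w)"
    using pos_def_coercive[OF B] by blast
  obtain bM where bM: "bM > 0" "\<And>v. bM * (norm v)\<^sup>2 \<le> v \<bullet> (M *v v)"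
    using pos_def_coercive[OF M(1)] by blast
  obtain bA where bA: "bA > 0" "\<And>v. bA * (norm v)\<^sup>2 \<le> v \<bullet> (A *v v)"
    using pos_def_coercive[OF A] by blast
  obtain CB where CB: "CB > 0" "\<And>w. norm (B *v w) \<le> CB * norm w"
    using matrix_vector_norm_bound[of B] by blast
  obtain CM where CM: "CM > 0" "\<And>v. norm (M *v v) \<le> CM * norm v"
    using matrix_vector_norm_bound[of M] by blast
  obtain CA where CA: "CA > 0" "\<And>v. norm (A *v v) \<le> CA * norm v"
    using matrix_vector_norm_bound[of A] by blast
  have inner_bound: "\<bar>u \<bullet> (N *v v)\<bar> \<le> C * norm u * norm v"
    if "\<And>v. norm (N *v v) \<le> C * norm v" for N :: "real^3^3" and C u v
  proof -
    have "\<bar>u \<bullet> (N *v v)\<bar> \<le> norm u * norm (N *v v)"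
      by (rule Cauchy_Schwarz_ineq2)
    also have "\<dots> \<le> norm u * (C * norm v)"
      using that by (intro mult_left_mono) auto
    finally show ?thesis
      by (simp add: mult_ac)
  qed
  define \<alpha> where "\<alpha> = stiffness"
  have \<alpha>: "\<alpha> > 0"
    using stiffness_pos by (simp add: \<alpha>_def)
  \<comment> \<open>The energy without the cross term is at least \<open>\<mu>\<close> times the
    squared distance.\<close>
  define \<mu> where "\<mu> = min (m / 2) (min (bM / 2) \<alpha>)"
  define \<beta> where "\<beta> = min bB bA"
  \<comment> \<open>Bounds the velocity coefficients in the derivative of the cross term: kinetic
    ones \<open>m\<close> and \<open>CM\<close>, and those left by Young's inequality from the
    damping.\<close>
  define D where "D = m + CM + CB\<^sup>2 / (2 * \<alpha>) + CA\<^sup>2 / (2 * \<alpha>)"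
  define \<epsilon> where "\<epsilon> = min (\<mu> / (m + CM)) (\<beta> / (2 * D))"
  have \<mu>: "\<mu> > 0" "\<mu> \<le> m / 2" "\<mu> \<le> bM / 2" "\<mu> \<le> \<alpha>"
    using pos bM \<alpha> by (auto simp: \<mu>_def)
  have \<beta>: "\<beta> > 0" "\<beta> \<le> bB" "\<beta> \<le> bA"
    using bB bA by (auto simp: \<beta>_def)
  have D: "D > 0"
    using pos CM \<alpha> by (simp add: D_def add_pos_nonneg)
  have \<epsilon>: "\<epsilon> > 0" "\<epsilon> * (m + CM) \<le> \<mu>" "\<epsilon> * D \<le> \<beta> / 2"
  proof -
    show "\<epsilon> > 0"
      using \<mu> \<beta> D pos CM by (simp add: \<epsilon>_def)
    have "\<epsilon> \<le> \<mu> / (m + CM)" "\<epsilon> \<le> \<beta> / (2 * D)"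
      by (auto simp: \<epsilon>_def)
    then show "\<epsilon> * (m + CM) \<le> \<mu>" "\<epsilon> * D \<le> \<beta> / 2"
      using D pos CM by (simp_all add: field_simps)
  qed
  have "strict_lyapunov F state_space xb (lyapunov \<epsilon>) (lyapunov' \<epsilon>) r
      (\<mu> / 2) (m + CM + (k + kH) + \<mu>) (min (\<beta> / 2) (\<epsilon> * \<alpha> / 2))"
  proof
    show "r > 0" "\<mu> / 2 > 0" "m + CM + (k + kH) + \<mu> > 0" "min (\<beta> / 2) (\<epsilon> * \<alpha> / 2) > 0"
      using r \<mu> \<beta> \<epsilon> \<alpha> pos CM by auto
    fix z assume z: "z \<in> state_space" "dist z xb \<le> r"
    obtain p w q v where z_eq: "z = (p, w, q, v)"
      by (cases z)
    let ?a = "p - pr" and ?b = "q - qr"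
    define a\<^sub>2 b\<^sub>2 w\<^sub>2 v\<^sub>2 where "a\<^sub>2 = (norm ?a)\<^sup>2" and "b\<^sub>2 = (norm ?b)\<^sup>2"
      and "w\<^sub>2 = (norm w)\<^sup>2" and "v\<^sub>2 = (norm v)\<^sup>2"
    note squares = a\<^sub>2_def[symmetric] b\<^sub>2_def[symmetric] w\<^sub>2_def[symmetric] v\<^sub>2_def[symmetric]
    have nonneg: "a\<^sub>2 \<ge> 0" "b\<^sub>2 \<ge> 0" "w\<^sub>2 \<ge> 0" "v\<^sub>2 \<ge> 0"
      by (auto simp: a\<^sub>2_def b\<^sub>2_def w\<^sub>2_def v\<^sub>2_def)
    have p: "z_W \<bullet> p = 0" and taut: "lb \<le> norm (q - p)"
      using z r(2) by (auto simp: z_eq state_space_def)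
    have dist: "(dist z xb)\<^sup>2 = a\<^sub>2 + w\<^sub>2 + b\<^sub>2 + v\<^sub>2"
      by (simp add: z_eq dist_xb squares)
    let ?U = "cable_potential k lb L (q - p) + kH / 2 * (horiz ?b \<bullet> horiz ?b)"
    let ?X = "m * (w \<bullet> ?a) + (M *v v) \<bullet> ?b"
    have W: "lyapunov \<epsilon> z = m / 2 * w\<^sub>2 + 1 / 2 * (v \<bullet> (M *v v)) + ?U + \<epsilon> * ?X"
      by (simp add: lyapunov_def z_eq w\<^sub>2_def power2_norm_eq_inner)
    note U = potential_bounds[OF p, of q, folded \<alpha>_def, unfolded squares]
    have "\<bar>?X\<bar> \<le> (m + CM) / 2 * (dist z xb)\<^sup>2"
    proof -
      have "\<bar>w \<bullet> ?a\<bar> \<le> norm w * norm ?a"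
        by (rule Cauchy_Schwarz_ineq2)
      also have "\<dots> \<le> (w\<^sub>2 + a\<^sub>2) / 2"
        using sum_squares_bound[of "norm w" "norm ?a"] by (simp add: w\<^sub>2_def a\<^sub>2_def)
      finally have 1: "\<bar>w \<bullet> ?a\<bar> \<le> (w\<^sub>2 + a\<^sub>2) / 2" .
      have "\<bar>(M *v v) \<bullet> ?b\<bar> \<le> CM * (norm ?b * norm v)"
        using inner_bound[OF CM(2), of ?b v] by (simp add: inner_commute mult.assoc)
      also have "\<dots> \<le> CM * ((b\<^sub>2 + v\<^sub>2) / 2)"
        using sum_squares_bound[of "norm ?b" "norm v"] CM
        by (intro mult_left_mono) (auto simp: v\<^sub>2_def b\<^sub>2_def)
      finally have 2: "\<bar>(M *v v) \<bullet> ?b\<bar> \<le> CM * ((b\<^sub>2 + v\<^sub>2) / 2)" .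
      have "\<bar>?X\<bar> \<le> m * \<bar>w \<bullet> ?a\<bar> + \<bar>(M *v v) \<bullet> ?b\<bar>"
        using pos by (metis abs_mult abs_of_pos abs_triangle_ineq)
      also have "\<dots> \<le> m * ((w\<^sub>2 + a\<^sub>2) / 2) + CM * ((b\<^sub>2 + v\<^sub>2) / 2)"
        using 1 2 pos by (intro add_mono mult_left_mono) auto
      also have "\<dots> \<le> m * ((dist z xb)\<^sup>2 / 2) + CM * ((dist z xb)\<^sup>2 / 2)"
        unfolding dist using nonneg pos CM by (intro add_mono mult_left_mono) auto
      finally show ?thesis
        by (simp add: field_simps)
    qed
    then have "\<epsilon> * \<bar>?X\<bar> \<le> \<epsilon> * ((m + CM) / 2 * (dist z xb)\<^sup>2)"
      using \<epsilon> by (intro mult_left_mono) auto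
    also have "\<dots> = \<epsilon> * (m + CM) * ((dist z xb)\<^sup>2 / 2)"
      by simp
    also have "\<dots> \<le> \<mu> * ((dist z xb)\<^sup>2 / 2)"
      using \<epsilon> by (intro mult_right_mono) auto
    finally have "\<bar>\<epsilon> * ?X\<bar> \<le> \<mu> / 2 * (dist z xb)\<^sup>2"
      using \<epsilon> by (simp add: abs_mult)
    then have X: "- (\<mu> / 2 * (dist z xb)\<^sup>2) \<le> \<epsilon> * ?X" "\<epsilon> * ?X \<le> \<mu> / 2 * (dist z xb)\<^sup>2"
      by linarith+
    have vM: "bM * v\<^sub>2 \<le> v \<bullet> (M *v v)" "v \<bullet> (M *v v) \<le> CM * v\<^sub>2"
      using bM(2)[of v] inner_bound[OF CM(2), of v v]
      by (auto simp: v\<^sub>2_def power2_eq_square mult.assoc)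
    show "\<mu> / 2 * (dist z xb)\<^sup>2 \<le> lyapunov \<epsilon> z"
    proof -
      have "\<mu> * (dist z xb)\<^sup>2 = \<mu> * w\<^sub>2 + \<mu> * v\<^sub>2 + \<mu> * (a\<^sub>2 + b\<^sub>2)"
        by (simp add: dist algebra_simps)
      also have "\<dots> \<le> m / 2 * w\<^sub>2 + bM / 2 * v\<^sub>2 + \<alpha> * (a\<^sub>2 + b\<^sub>2)"
        using \<mu> nonneg by (intro add_mono mult_right_mono) auto
      finally show ?thesis
        using U(1) X(1) vM(1) unfolding W by simp
    qed
    show "lyapunov \<epsilon> z \<le> (m + CM + (k + kH) + \<mu>) * (dist z xb)\<^sup>2"
    proof -
      let ?N = "(dist z xb)\<^sup>2"
      have "m / 2 * w\<^sub>2 \<le> m * ?N" "CM / 2 * v\<^sub>2 \<le> CM * ?N" "(k + kH) * (a\<^sub>2 + b\<^sub>2) \<le> (k + kH) * ?N"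
          "\<mu> / 2 * ?N \<le> \<mu> * ?N"
        using nonneg pos CM \<mu> unfolding dist by (auto intro!: mult_mono)
      then show ?thesis
        using U(2) X(2) vM(2) unfolding W by (simp add: distrib_right)
    qed
    show "(lyapunov \<epsilon> has_derivative lyapunov' \<epsilon> z) (at z)"
      using z_eq taut by (rule lyapunov_has_derivative)
    show "lyapunov' \<epsilon> z (F z) \<le> - min (\<beta> / 2) (\<epsilon> * \<alpha> / 2) * (dist z xb)\<^sup>2"
    proof -
      let ?R = "force_dev (q - p) \<bullet> (?b - ?a) + kH * (norm (horiz ?b))\<^sup>2"
      let ?Y = "m * w\<^sub>2 + v \<bullet> (M *v v) - ?a \<bullet> (B *v w) - ?b \<bullet> (A *v v) - ?R"
      \<comment> \<open>The weight \<open>\<alpha>\<close> spends half of the restoring term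
        \<open>\<alpha> * (a\<^sub>2 + b\<^sub>2)\<close> on the mixed damping terms and leaves the
        other half.\<close>
      have young: "- (u \<bullet> (N *v y)) \<le> \<alpha> / 2 * (norm u)\<^sup>2 + C\<^sup>2 / (2 * \<alpha>) * (norm y)\<^sup>2"
        if "\<And>v. norm (N *v v) \<le> C * norm v" for N :: "real^3^3" and C u y
        using inner_bound[OF that, of u y] weighted_young[OF \<alpha>, of C "norm u" "norm y"] by simp
      have "?Y \<le> m * w\<^sub>2 + CM * v\<^sub>2 + (\<alpha> / 2 * a\<^sub>2 + CB\<^sup>2 / (2 * \<alpha>) * w\<^sub>2)
          + (\<alpha> / 2 * b\<^sub>2 + CA\<^sup>2 / (2 * \<alpha>) * v\<^sub>2) - \<alpha> * (a\<^sub>2 + b\<^sub>2)"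
        using young[OF CB(2), of ?a w] young[OF CA(2), of ?b v] U(3)[OF taut] vM(2)
        unfolding squares by linarith
      also have "\<dots> = (m + CB\<^sup>2 / (2 * \<alpha>)) * w\<^sub>2 + (CM + CA\<^sup>2 / (2 * \<alpha>)) * v\<^sub>2 - \<alpha> / 2 * (a\<^sub>2 + b\<^sub>2)"
        by (simp add: algebra_simps)
      also have "\<dots> \<le> D * w\<^sub>2 + D * v\<^sub>2 - \<alpha> / 2 * (a\<^sub>2 + b\<^sub>2)"
        using nonneg pos CM \<alpha> by (intro diff_right_mono add_mono mult_right_mono) (auto simp: D_def)
      finally have "\<epsilon> * ?Y \<le> \<epsilon> * (D * w\<^sub>2 + D * v\<^sub>2 - \<alpha> / 2 * (a\<^sub>2 + b\<^sub>2))"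
        using \<epsilon> by (intro mult_left_mono) auto
      also have "\<dots> = \<epsilon> * D * (w\<^sub>2 + v\<^sub>2) - \<epsilon> * \<alpha> / 2 * (a\<^sub>2 + b\<^sub>2)"
        by (simp add: algebra_simps)
      also have "\<dots> \<le> \<beta> / 2 * (w\<^sub>2 + v\<^sub>2) - \<epsilon> * \<alpha> / 2 * (a\<^sub>2 + b\<^sub>2)"
        using \<epsilon> nonneg by (intro diff_right_mono mult_right_mono) auto
      finally have Y: "\<epsilon> * ?Y \<le> \<beta> / 2 * (w\<^sub>2 + v\<^sub>2) - \<epsilon> * \<alpha> / 2 * (a\<^sub>2 + b\<^sub>2)" .
      have "\<beta> * w\<^sub>2 \<le> w \<bullet> (B *v w)" "\<beta> * v\<^sub>2 \<le> v \<bullet> (A *v v)"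
        using order_trans[OF mult_right_mono[OF \<beta>(2) nonneg(3)]] bB(2)[of w]
          order_trans[OF mult_right_mono[OF \<beta>(3) nonneg(4)]] bA(2)[of v] by (auto simp: squares)
      moreover have "lyapunov' \<epsilon> z (F z) = - (w \<bullet> (B *v w)) - v \<bullet> (A *v v) + \<epsilon> * ?Y"
        using lyapunov'_F[of p w q v \<epsilon>] z unfolding z_eq squares by simp
      ultimately have "lyapunov' \<epsilon> z (F z) \<le> - (\<beta> / 2 * (w\<^sub>2 + v\<^sub>2)) - \<epsilon> * \<alpha> / 2 * (a\<^sub>2 + b\<^sub>2)"
        using Y by (simp add: distrib_left)
      moreover have "min (\<beta> / 2) (\<epsilon> * \<alpha> / 2) * (w\<^sub>2 + v\<^sub>2) \<le> \<beta> / 2 * (w\<^sub>2 + v\<^sub>2)"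
          "min (\<beta> / 2) (\<epsilon> * \<alpha> / 2) * (a\<^sub>2 + b\<^sub>2) \<le> \<epsilon> * \<alpha> / 2 * (a\<^sub>2 + b\<^sub>2)"
        using nonneg by (intro mult_right_mono; simp)+
      moreover have "(dist z xb)\<^sup>2 = (w\<^sub>2 + v\<^sub>2) + (a\<^sub>2 + b\<^sub>2)"
        by (simp add: dist)
      ultimately show ?thesis
        by (simp only: distrib_left mult_minus_left)
    qed
  qed
  then show thesis
    using that r(2) by blast
qed

theorem asymptotically_stable_xb:
  "asymptotically_stable (motion F state_space (ground_intensity m g k lb B)) state_space xb"
proof -
  obtain \<epsilon> r c1 c2 c3 where
    W: "strict_lyapunov F state_space xb (lyapunov \<epsilon>) (lyapunov' \<epsilon>) r c1 c2 c3"
    and r: "\<And>p w q v. dist (p, w, q, v) xb \<le> r \<Longrightarrow>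
       lb \<le> norm (q - p) \<and> ground_intensity m g k lb B (p, w, q, v) \<ge> 0"
    using strict_lyapunov_exists by blast
  obtain C where "C-lipschitz_on {(p, w, q, v). lb \<le> norm (q - p)} F"
    using F_lipschitz by blast
  then have C: "C-lipschitz_on (state_space \<inter> cball xb r) F"
    by (rule lipschitz_on_subset) (use r in \<open>auto simp: dist_commute\<close>)
  show ?thesis
  proof (rule strict_lyapunov.asymptotically_stable[OF W subspace_state_space xb_state_space _ C])
    fix z assume "z \<in> state_space" "dist z xb \<le> r"
    then show "F z \<in> state_space" "ground_intensity m g k lb B z \<ge> 0"
      using F_state_space r by (cases z; auto)+
  qed
qed

end

theorem theorem1:
  fixes m_H g k_c lbar_c k_H f_z :: real
    and B_H M_A B_A K_H :: "real^3^3"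
    and p_Hr p_Rr f_cr :: "real^3"
    and F :: "state \<Rightarrow> state"
    and xb :: state
  assumes "m_H > 0" "g > 0" "k_c > 0" "lbar_c > 0" "k_H > 0"
    and "pos_def B_H"
    and "pos_def M_A" "is_diagonal M_A"
    and "pos_def B_A" "is_diagonal B_A"
    and "K_H = diag (vector [k_H, k_H, 0])"
    and "z_W \<bullet> p_Hr = 0"
    and "f_cr = force_ref f_z"
    and "p_Rr = robot_ref k_c lbar_c p_Hr f_cr"
    and "F = (\<lambda>x. system_field m_H g k_c lbar_c B_H M_A B_A (control K_H p_Rr f_cr x) x)"
    and "xb = (p_Hr, 0, p_Rr, 0)"
    and "0 < f_z" "f_z < m_H * g"
  shows "equilibrium F state_space xb
    \<and> norm (p_Rr - p_Hr) > lbar_c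
    \<and> asymptotically_stable
        (motion F state_space (ground_intensity m_H g k_c lbar_c B_H)) state_space xb"
proof -
  interpret tethered_robot m_H g k_c lbar_c k_H f_z B_H M_A B_A K_H p_Hr p_Rr f_cr F xb
    using assms by unfold_locales
  show ?thesis
    using equilibrium_xb asymptotically_stable_xb norm_cable_ref L(1) by simp
qed

end
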